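(* Let $q\ge1$ and let $(u_h^n,w_h^n)\in V_h^q\times V_h^q$, $n=0,1,\dots,N_t$, be a solution of the fully discrete ultra-weak LDG scheme with Crank--Nicolson time discretization: for every $n$ with $1\le n\le N_t-1$, every $K\in\Omega_h$ and all $\phi,\psi\in V_h^q$, $$\int_K i\,\delta u_h^n\,\phi+\bar\delta w_h^n\,\Delta\phi+\bar\delta u_h^n\,\mathcal{G}\,\phi\,d\mathbf{x}=\int_{\partial K}-\bar\delta\widetilde{\nabla w_h^n}\cdot\mathbf{n}\,\phi+\bar\delta\widetilde{w_h^n}\,\nabla\phi\cdot\mathbf{n}\,dS,$$ $$\int_K w_h^{n+1}\psi-u_h^{n+1}\Delta\psi\,d\mathbf{x}=\int_{\partial K}\widehat{\nabla u_h^{n+1}}\cdot\mathbf{n}\,\psi-\widehat{u_h^{n+1}}\,\nabla\psi\cdot\mathbf{n}\,dS,$$ $$\int_K w_h^{n-1}\psi-u_h^{n-1}\Delta\psi\,d\mathbf{x}=\int_{\partial K}\widehat{\nabla u_h^{n-1}}\cdot\mathbf{n}\,\psi-\widehat{u_h^{n-1}}\,\nabla\psi\cdot\mathbf{n}\,dS,$$ where $$\mathcal{G}=\frac{F(|u_h^{n+1}|^2)-F(|u_h^{n-1}|^2)}{|u_h^{n+1}|^2-|u_h^{n-1}|^2},$$ with periodic boundary conditions and numerical fluxes $\widehat{u_h}=u_h^+$, $\widetilde{\nabla w_h}=\nabla w_h^-$, $\widehat{\nabla u_h}=\nabla u_h^+$, $\widetilde{w_h}=w_h^-$. Then for all $n$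 the scheme conserves the discrete mass $$M_h^{n+1}:=\frac12\sum_K\int_K|u_h^n|^2+|u_h^{n+1}|^2\,d\mathbf{x}$$ and the discrete Hamiltonian $$H_h^{n+1}:=\frac12\sum_K\int_K|w_h^n|^2+|w_h^{n+1}|^2+F(|u_h^{n+1}|^2)+F(|u_h^n|^2)\,d\mathbf{x},$$ that is, $M_h^{n+1}=M_h^n$ and $H_h^{n+1}=H_h^n$ for all $n$ with $1\le n\le N_t-1$.
   Context: The scheme approximates the nonlinear biharmonic Schrödinger equation $iu_t+\Delta^2u=-uF'(|u|^2)$ on $\Omega\subseteq\mathbb{R}^d$, $d\in\{1,2\}$, with periodic boundary conditions, rewritten as $iu_t=-\Delta w-uF'(|u|^2)$, $w=\Delta u$; here $u$ is complex-valued, $i=\sqrt{-1}$, $F$ is a real function with derivative $F'$, and $F(|u|^2)\ge0$. Time grid: $0=t_0<t_1<\dots<t_{N_t}=T$ with uniform step $h_t=t_{n+1}-t_n$; $u_h^n,w_h^n$ are the discrete solutions at $t=t_n$. Operators: $\delta v^n=\dfrac{v^{n+1}-v^{n-1}}{2h_t}$ and $\bar\delta v^n=\dfrac{v^{n+1}+v^{n-1}}{2}$, also applied to numerical fluxes. At points where $|u_h^{n+1}|^2=|u_h^{n-1}|^2$ the quotient $\mathcal{G}$ is understood as $F'(|u_h^{n+1}|^2)$. Mesh: $\Omega_h$ is a tessellation of $\Omega$ into shape-regular elements $K$; for $d=1$ the elements are intervals $(x_{j-1/2},x_{j+1/2})$, and for $d=2$ they are the rectangles $(x_{k-1/2},x_{k+1/2})\times(y_{j-1/2},y_{j+1/2})$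 of a Cartesian grid. Finite element space: $V_h^q$ is the space of functions whose restriction to each $K$ is in $\mathcal{Q}^q(K)$, the space of complex tensor-product polynomials of degree at most $q$ in each variable; no continuity across elements is imposed. Traces: on each face (point for $d=1$, edge for $d=2$) shared by two elements, $v^-$ denotes the trace from the left (or bottom) element and $v^+$ the trace from the right (or top) element; faces on the boundary of $\Omega$ are identified periodically. $\mathbf{n}$ is the outward unit normal to $\partial K$; in $\partial K$-integrals the test functions are the traces taken from inside $K$. No complex conjugation is applied to the test functions. *)

theory Defs
  imports "HOL-Analysis.Analysis"
begin

text \<open>
  Space is a Euclidean space \<open>'a\<close> with coordinates \<open>x \<bullet> b\<close>, \<open>b \<in> Basis\<close>.  A Cartesian mesh on the
  box \<open>\<Omega> = box lo hi\<close> has \<open>N b\<close> intervals with nodes \<open>X b 0 < \<dots> < X b (N b)\<close> in direction \<open>b\<close>.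
  Its elements are indexed by functions \<open>J\<close> with \<open>J b < N b\<close>.  For \<open>DIM('a) = 1\<close> the elements are
  intervals, for \<open>DIM('a) = 2\<close> they are rectangles.
\<close>

definition cartesian_mesh ::
    "'a::euclidean_space \<Rightarrow> 'a \<Rightarrow> ('a \<Rightarrow> nat) \<Rightarrow> ('a \<Rightarrow> nat \<Rightarrow> real) \<Rightarrow> bool" where
  "cartesian_mesh lo hi N X \<longleftrightarrow>
     (\<forall>b\<in>Basis. 0 < N b \<and> X b 0 = lo \<bullet> b \<and> X b (N b) = hi \<bullet> b \<and> (\<forall>j<N b. X b j < X b (Suc j)))"

definition cells :: "('a::euclidean_space \<Rightarrow> nat) \<Rightarrow> ('a \<Rightarrow> nat) set" where
  "cells N = (\<Pi>\<^sub>E b\<in>Basis. {..<N b})"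

definition elem :: "('a::euclidean_space \<Rightarrow> nat \<Rightarrow> real) \<Rightarrow> ('a \<Rightarrow> nat) \<Rightarrow> 'a set" where
  "elem X J = box (\<Sum>b\<in>Basis. X b (J b) *\<^sub>R b) (\<Sum>b\<in>Basis. X b (Suc (J b)) *\<^sub>R b)"

text \<open>Periodic neighbours of an element in direction \<open>b\<close>.\<close>

definition next_cell :: "('a \<Rightarrow> nat) \<Rightarrow> 'a \<Rightarrow> ('a \<Rightarrow> nat) \<Rightarrow> 'a \<Rightarrow> nat" where
  "next_cell N b J = J(b := (J b + 1) mod N b)"

definition prev_cell :: "('a \<Rightarrow> nat) \<Rightarrow> 'a \<Rightarrow> ('a \<Rightarrow> nat) \<Rightarrow> 'a \<Rightarrow> nat" where
  "prev_cell N b J = J(b := (J b + N b - 1) mod N b)"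

definition tensor_poly :: "nat \<Rightarrow> ('a::euclidean_space \<Rightarrow> complex) set" where
  "tensor_poly q = {p. \<exists>c :: ('a \<Rightarrow> nat) \<Rightarrow> complex. \<forall>x.
     p x = (\<Sum>\<alpha>\<in>(\<Pi>\<^sub>E b\<in>Basis. {..q}). c \<alpha> * (\<Prod>b\<in>Basis. complex_of_real (x \<bullet> b) ^ \<alpha> b))}"

definition dg_space ::
    "nat \<Rightarrow> ('a::euclidean_space \<Rightarrow> nat) \<Rightarrow> ('a \<Rightarrow> nat \<Rightarrow> real) \<Rightarrow> ('a \<Rightarrow> complex) set" where
  "dg_space q N X = {v. \<forall>J\<in>cells N. \<exists>p\<in>tensor_poly q. \<forall>x\<in>elem X J. v x = p x}"

definition pderiv_dir :: "'a::euclidean_space \<Rightarrow> ('a \<Rightarrow> complex) \<Rightarrow> 'a \<Rightarrow> complex" where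
  "pderiv_dir b v x = vector_derivative (\<lambda>t. v (x + t *\<^sub>R b)) (at 0)"

definition laplacian :: "('a::euclidean_space \<Rightarrow> complex) \<Rightarrow> 'a \<Rightarrow> complex" where
  "laplacian v x = (\<Sum>b\<in>Basis. pderiv_dir b (pderiv_dir b v) x)"

text \<open>
  A point of the hyperplane \<open>x \<bullet> b = s\<close> is given by its remaining coordinates \<open>y\<close>, a function on
  \<open>Basis - {b}\<close>.  The surface measure on this hyperplane is the product Lebesgue measure in \<open>y\<close>.  For
  \<open>DIM('a) = 1\<close> this is the unit mass at a single point, so that integration over a face is
  evaluation.
\<close>

definition face_point :: "'a::euclidean_space \<Rightarrow> real \<Rightarrow> ('a \<Rightarrow> real) \<Rightarrow> 'a" where
  "face_point b s y = s *\<^sub>R b + (\<Sum>c\<in>Basis - {b}. y c *\<^sub>R c)"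

definition face_integral ::
    "('a::euclidean_space \<Rightarrow> nat \<Rightarrow> real) \<Rightarrow> ('a \<Rightarrow> nat) \<Rightarrow> 'a \<Rightarrow> (('a \<Rightarrow> real) \<Rightarrow> complex) \<Rightarrow> complex" where
  "face_integral X J b f =
     (LINT y : (\<Pi>\<^sub>E c\<in>Basis - {b}. {X c (J c)<..<X c (Suc (J c))}) | (\<Pi>\<^sub>M c\<in>Basis - {b}. lborel). f y)"

text \<open>Traces from inside element \<open>J\<close> on its faces with outward normal \<open>b\<close> and \<open>- b\<close>.\<close>

definition upper_trace ::
    "('a::euclidean_space \<Rightarrow> nat \<Rightarrow> real) \<Rightarrow> ('a \<Rightarrow> nat) \<Rightarrow> 'a \<Rightarrow> ('a \<Rightarrow> complex) \<Rightarrow> ('a \<Rightarrow> real) \<Rightarrow> complex" where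
  "upper_trace X J b v y = Lim (at (face_point b (X b (Suc (J b))) y) within elem X J) v"

definition lower_trace ::
    "('a::euclidean_space \<Rightarrow> nat \<Rightarrow> real) \<Rightarrow> ('a \<Rightarrow> nat) \<Rightarrow> 'a \<Rightarrow> ('a \<Rightarrow> complex) \<Rightarrow> ('a \<Rightarrow> real) \<Rightarrow> complex" where
  "lower_trace X J b v y = Lim (at (face_point b (X b (J b)) y) within elem X J) v"

text \<open>
  A face orthogonal to \<open>b\<close> is named by the element \<open>L\<close> on its left (or bottom), so that
  \<open>next_cell N b L\<close> is the element on its right (or top), also across the periodic boundary.
  The following are \<open>v\<^sup>-\<close> and \<open>v\<^sup>+\<close> on this face.
\<close>

definition minus_trace ::
    "('a::euclidean_space \<Rightarrow> nat \<Rightarrow> real) \<Rightarrow> ('a \<Rightarrow> complex) \<Rightarrow> 'a \<Rightarrow> ('a \<Rightarrow> nat) \<Rightarrow> ('a \<Rightarrow> real) \<Rightarrow> complex" where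
  "minus_trace X v b L y = upper_trace X L b v y"

definition plus_trace ::
    "('a::euclidean_space \<Rightarrow> nat) \<Rightarrow> ('a \<Rightarrow> nat \<Rightarrow> real) \<Rightarrow> ('a \<Rightarrow> complex) \<Rightarrow> 'a \<Rightarrow> ('a \<Rightarrow> nat) \<Rightarrow> ('a \<Rightarrow> real) \<Rightarrow> complex" where
  "plus_trace N X v b L y = lower_trace X (next_cell N b L) b v y"

text \<open>
  With \<open>K = elem X J\<close>, \<open>boundary_integral N X J g T\<close> is the integral over \<open>\<partial>K\<close> of the sum over \<open>b\<close> of
  \<open>(n \<bullet> b) g\<^sub>b T\<^sub>b\<close>, where \<open>n\<close> is the outward unit normal, \<open>g b L\<close> is the numerical flux on the face
  orthogonal to \<open>b\<close> named by \<open>L\<close>, and \<open>T b\<close> is the test quantity, traced from inside \<open>K\<close>.  For a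
  vector-valued flux \<open>g\<close> and \<open>T b = \<psi>\<close> the integrand is \<open>(g \<bullet> n) \<psi>\<close>.  For a scalar flux \<open>g\<close> and
  \<open>T b = \<partial>\<^sub>b \<psi>\<close> it is \<open>g (\<nabla>\<psi> \<bullet> n)\<close>.
\<close>

definition boundary_integral ::
    "('a::euclidean_space \<Rightarrow> nat) \<Rightarrow> ('a \<Rightarrow> nat \<Rightarrow> real) \<Rightarrow> ('a \<Rightarrow> nat)
      \<Rightarrow> ('a \<Rightarrow> ('a \<Rightarrow> nat) \<Rightarrow> ('a \<Rightarrow> real) \<Rightarrow> complex) \<Rightarrow> ('a \<Rightarrow> 'a \<Rightarrow> complex) \<Rightarrow> complex" where
  "boundary_integral N X J g T = (\<Sum>b\<in>Basis.
       face_integral X J b (\<lambda>y. g b J y * upper_trace X J b (T b) y)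
     - face_integral X J b (\<lambda>y. g b (prev_cell N b J) y * lower_trace X J b (T b) y))"

text \<open>The numerical fluxes for \<open>u\<close>, \<open>\<nabla>u\<close>, \<open>w\<close> and \<open>\<nabla>w\<close>; the gradient fluxes are given by components.\<close>

definition flux_u ::
    "('a::euclidean_space \<Rightarrow> nat) \<Rightarrow> ('a \<Rightarrow> nat \<Rightarrow> real) \<Rightarrow> ('a \<Rightarrow> complex) \<Rightarrow> 'a \<Rightarrow> ('a \<Rightarrow> nat) \<Rightarrow> ('a \<Rightarrow> real) \<Rightarrow> complex" where
  "flux_u N X u b L y = plus_trace N X u b L y"

definition flux_grad_u ::
    "('a::euclidean_space \<Rightarrow> nat) \<Rightarrow> ('a \<Rightarrow> nat \<Rightarrow> real) \<Rightarrow> ('a \<Rightarrow> complex) \<Rightarrow> 'a \<Rightarrow> ('a \<Rightarrow> nat) \<Rightarrow> ('a \<Rightarrow> real) \<Rightarrow> complex" where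
  "flux_grad_u N X u b L y = plus_trace N X (pderiv_dir b u) b L y"

definition flux_w ::
    "('a::euclidean_space \<Rightarrow> nat \<Rightarrow> real) \<Rightarrow> ('a \<Rightarrow> complex) \<Rightarrow> 'a \<Rightarrow> ('a \<Rightarrow> nat) \<Rightarrow> ('a \<Rightarrow> real) \<Rightarrow> complex" where
  "flux_w X w b L y = minus_trace X w b L y"

definition flux_grad_w ::
    "('a::euclidean_space \<Rightarrow> nat \<Rightarrow> real) \<Rightarrow> ('a \<Rightarrow> complex) \<Rightarrow> 'a \<Rightarrow> ('a \<Rightarrow> nat) \<Rightarrow> ('a \<Rightarrow> real) \<Rightarrow> complex" where
  "flux_grad_w X w b L y = minus_trace X (pderiv_dir b w) b L y"

definition uniform_time_grid :: "(nat \<Rightarrow> real) \<Rightarrow> real \<Rightarrow> nat \<Rightarrow> real \<Rightarrow> bool" where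
  "uniform_time_grid t h Nt T \<longleftrightarrow>
     t 0 = 0 \<and> t Nt = T \<and> (\<forall>n<Nt. t n < t (Suc n) \<and> h = t (Suc n) - t n)"

text \<open>Central time difference and time average; both are used only for \<open>n \<ge> 1\<close>.\<close>

definition tdiff :: "real \<Rightarrow> (nat \<Rightarrow> complex) \<Rightarrow> nat \<Rightarrow> complex" where
  "tdiff h v n = (v (n + 1) - v (n - 1)) / complex_of_real (2 * h)"

definition tavg :: "(nat \<Rightarrow> complex) \<Rightarrow> nat \<Rightarrow> complex" where
  "tavg v n = (v (n + 1) + v (n - 1)) / 2"

definition diff_quot :: "(real \<Rightarrow> real) \<Rightarrow> (real \<Rightarrow> real) \<Rightarrow> real \<Rightarrow> real \<Rightarrow> real" where
  "diff_quot F F' r s = (if r = s then F' r else (F r - F s) / (r - s))"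

definition first_eq_integrand ::
    "(real \<Rightarrow> real) \<Rightarrow> (real \<Rightarrow> real) \<Rightarrow> real \<Rightarrow> (nat \<Rightarrow> 'a::euclidean_space \<Rightarrow> complex)
      \<Rightarrow> (nat \<Rightarrow> 'a \<Rightarrow> complex) \<Rightarrow> nat \<Rightarrow> ('a \<Rightarrow> complex) \<Rightarrow> 'a \<Rightarrow> complex" where
  "first_eq_integrand F F' h u w n \<phi> x =
       \<i> * tdiff h (\<lambda>m. u m x) n * \<phi> x
     + tavg (\<lambda>m. w m x) n * laplacian \<phi> x
     + tavg (\<lambda>m. u m x) n
         * complex_of_real (diff_quot F F' ((cmod (u (n + 1) x))\<^sup>2) ((cmod (u (n - 1) x))\<^sup>2)) * \<phi> x"

definition second_eq ::
    "('a::euclidean_space \<Rightarrow> nat) \<Rightarrow> ('a \<Rightarrow> nat \<Rightarrow> real) \<Rightarrow> ('a \<Rightarrow> nat)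
      \<Rightarrow> ('a \<Rightarrow> complex) \<Rightarrow> ('a \<Rightarrow> complex) \<Rightarrow> ('a \<Rightarrow> complex) \<Rightarrow> bool" where
  "second_eq N X J u w \<psi> \<longleftrightarrow>
     (LINT x : elem X J | lborel. w x * \<psi> x - u x * laplacian \<psi> x)
       = boundary_integral N X J (flux_grad_u N X u) (\<lambda>b. \<psi>)
         - boundary_integral N X J (flux_u N X u) (\<lambda>b. pderiv_dir b \<psi>)"

text \<open>
  The integrability condition is part of the meaning of the first equation: the integral in
  HOL is total, and the difference quotient of \<open>F\<close> may be unbounded when \<open>F'\<close> is not
  continuous.  The other integrands are piecewise polynomial.
\<close>

definition cn_ldg_solution ::
    "(real \<Rightarrow> real) \<Rightarrow> (real \<Rightarrow> real) \<Rightarrow> real \<Rightarrow> nat \<Rightarrow> nat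
      \<Rightarrow> ('a::euclidean_space \<Rightarrow> nat) \<Rightarrow> ('a \<Rightarrow> nat \<Rightarrow> real)
      \<Rightarrow> (nat \<Rightarrow> 'a \<Rightarrow> complex) \<Rightarrow> (nat \<Rightarrow> 'a \<Rightarrow> complex) \<Rightarrow> bool" where
  "cn_ldg_solution F F' h Nt q N X u w \<longleftrightarrow>
     (\<forall>n\<le>Nt. u n \<in> dg_space q N X \<and> w n \<in> dg_space q N X) \<and>
     (\<forall>n. 1 \<le> n \<and> n \<le> Nt - 1 \<longrightarrow>
       (\<forall>J\<in>cells N. \<forall>\<phi>\<in>dg_space q N X. \<forall>\<psi>\<in>dg_space q N X.
          set_integrable lborel (elem X J) (first_eq_integrand F F' h u w n \<phi>) \<and>
          (LINT x : elem X J | lborel. first_eq_integrand F F' h u w n \<phi> x)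
            = - boundary_integral N X J
                  (\<lambda>b L y. tavg (\<lambda>m. flux_grad_w X (w m) b L y) n) (\<lambda>b. \<phi>)
              + boundary_integral N X J
                  (\<lambda>b L y. tavg (\<lambda>m. flux_w X (w m) b L y) n) (\<lambda>b. pderiv_dir b \<phi>) \<and>
          second_eq N X J (u (n + 1)) (w (n + 1)) \<psi> \<and>
          second_eq N X J (u (n - 1)) (w (n - 1)) \<psi>))"

text \<open>Discrete mass and Hamiltonian at time index \<open>m \<ge> 1\<close>, built from the levels \<open>m - 1\<close> and \<open>m\<close>.\<close>

definition discrete_mass ::
    "('a::euclidean_space \<Rightarrow> nat) \<Rightarrow> ('a \<Rightarrow> nat \<Rightarrow> real) \<Rightarrow> (nat \<Rightarrow> 'a \<Rightarrow> complex) \<Rightarrow> nat \<Rightarrow> real" where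
  "discrete_mass N X u m =
     1 / 2 * (\<Sum>J\<in>cells N. LINT x : elem X J | lborel. (cmod (u (m - 1) x))\<^sup>2 + (cmod (u m x))\<^sup>2)"

definition discrete_hamiltonian ::
    "(real \<Rightarrow> real) \<Rightarrow> ('a::euclidean_space \<Rightarrow> nat) \<Rightarrow> ('a \<Rightarrow> nat \<Rightarrow> real)
      \<Rightarrow> (nat \<Rightarrow> 'a \<Rightarrow> complex) \<Rightarrow> (nat \<Rightarrow> 'a \<Rightarrow> complex) \<Rightarrow> nat \<Rightarrow> real" where
  "discrete_hamiltonian F N X u w m =
     1 / 2 * (\<Sum>J\<in>cells N. LINT x : elem X J | lborel.
        (cmod (w (m - 1) x))\<^sup>2 + (cmod (w m x))\<^sup>2
          + F ((cmod (u m x))\<^sup>2) + F ((cmod (u (m - 1) x))\<^sup>2))"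

end

theory Submission
  imports Defs
begin

text \<open>
  The two equations of the scheme contain two discretisations of the Laplacian: for \<open>u\<close> the
  interface values are taken from the right (or top) element, for \<open>w\<close> from the left (or bottom) one.
  The proof rests on the fact that, summed over the periodic grid, these are transposes of each
  other.  Write \<open>B\<^sub>J\<^sup>+(v, w)\<close> (\<open>plus_form\<close>) and \<open>B\<^sub>J\<^sup>-(w, v)\<close> (\<open>minus_form\<close>) for the ultra-weak
  forms on the element \<open>J\<close>, with trial function first and test function second.  Green's identity
  on each element (\<open>green_elem\<close>) removes the volume terms from \<open>B\<^sub>J\<^sup>-(w, v) - B\<^sub>J\<^sup>+(v, w)\<close> and
  cancels every product of two traces from the inside of the element.  For each direction there
  remains an interface quantity on the upper face, formed from the right trace of \<open>v\<close> and the left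
  trace of \<open>w\<close>, minus the same quantity on the lower face; the sum over a periodic row of elements
  telescopes (\<open>minus_form_adjoint_plus_form\<close>).

  The second equation says \<open>B\<^sub>J\<^sup>+(u, \<psi>) = \<integral> w \<psi>\<close>, that is, \<open>w\<close> is a numerical Laplacian of \<open>u\<close>.
  This relation is linear, and it is preserved by complex conjugation since the coordinates are real.
  With \<open>U\<close>, \<open>W\<close> the time averages at step \<open>n\<close>, duality turns the first equation, tested with any
  \<open>\<phi>\<close> that has a numerical Laplacian \<open>\<omega>\<close> and summed over all elements, into
  \<open>\<Sum>\<^sub>J \<integral>\<^sub>J i \<delta>u \<phi> + W \<omega> + U \<G> \<phi> = 0\<close>
  without any boundary term (\<open>scheme_tested_numerical_laplacian\<close>).

  Mass: for \<open>\<phi>\<close> the conjugate of \<open>U\<close>, \<open>\<omega>\<close> is the conjugate of \<open>W\<close>, so the last two terms are real.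
  The imaginary part of the first one is \<open>(|u\<^sup>n\<^sup>+\<^sup>1|\<^sup>2 - |u\<^sup>n\<^sup>-\<^sup>1|\<^sup>2) / 4h\<close>.

  Hamiltonian: for \<open>\<phi>\<close> the conjugate of \<open>u\<^sup>n\<^sup>+\<^sup>1 - u\<^sup>n\<^sup>-\<^sup>1\<close>, the first term is purely imaginary.  The real
  part of the other two is half the increment of \<open>|w|\<^sup>2 + F(|u|\<^sup>2)\<close> from level \<open>n - 1\<close> to level
  \<open>n + 1\<close>, because the quotient \<open>\<G>\<close> is built so that multiplication by the increment of \<open>|u|\<^sup>2\<close>
  gives the increment of \<open>F(|u|\<^sup>2)\<close>.

  The level \<open>n\<close> contributes equally to both sides of the two conservation laws, so that only the
  levels \<open>n - 1\<close> and \<open>n + 1\<close>, which the scheme couples, have to be compared.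
\<close>

section \<open>Integrals of complex-valued functions\<close>

lemma set_integral_cnj:
  "(LINT x:A|M. cnj (f x)) = cnj (LINT x:A|M. f x)"
proof -
  have "(LINT x:A|M. cnj (f x)) = (LINT x|M. cnj (indicator A x *\<^sub>R f x))"
    unfolding set_lebesgue_integral_def by (intro Bochner_Integration.integral_cong) auto
  also have "\<dots> = cnj (LINT x|M. indicator A x *\<^sub>R f x)"
    by (rule Bochner_Integration.integral_cnj)
  finally show ?thesis
    by (simp add: set_lebesgue_integral_def)
qed

lemma set_integral_Re:
  "set_integrable M A f \<Longrightarrow> Re (LINT x:A|M. f x) = (LINT x:A|M. Re (f x))"
  and set_integral_Im:
  "set_integrable M A f \<Longrightarrow> Im (LINT x:A|M. f x) = (LINT x:A|M. Im (f x))"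
  unfolding set_lebesgue_integral_def set_integrable_def
  by (simp_all flip: integral_Re integral_Im)

section \<open>Polynomials in the coordinates\<close>

text \<open>
  Green's identity needs products of elements of the finite element space.  Tensor polynomials of a
  fixed degree are not closed under products, so the analysis is done with polynomials of arbitrary
  degree.
\<close>

inductive_set coord_polys :: "('a::euclidean_space \<Rightarrow> complex) set" where
  const: "(\<lambda>x. c) \<in> coord_polys"
| coord: "b \<in> Basis \<Longrightarrow> (\<lambda>x. complex_of_real (x \<bullet> b)) \<in> coord_polys"
| add: "p \<in> coord_polys \<Longrightarrow> r \<in> coord_polys \<Longrightarrow> (\<lambda>x. p x + r x) \<in> coord_polys"
| mult: "p \<in> coord_polys \<Longrightarrow> r \<in> coord_polys \<Longrightarrow> (\<lambda>x. p x * r x) \<in> coord_polys"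

lemma coord_polys_sum:
  "(\<And>i. i \<in> I \<Longrightarrow> p i \<in> coord_polys) \<Longrightarrow> (\<lambda>x. \<Sum>i\<in>I. p i x) \<in> coord_polys"
  by (induction I rule: infinite_finite_induct) (auto intro: coord_polys.intros)

lemma coord_polys_prod:
  "(\<And>i. i \<in> I \<Longrightarrow> p i \<in> coord_polys) \<Longrightarrow> (\<lambda>x. \<Prod>i\<in>I. p i x) \<in> coord_polys"
  by (induction I rule: infinite_finite_induct) (auto intro: coord_polys.intros)

lemma coord_polys_power: "p \<in> coord_polys \<Longrightarrow> (\<lambda>x. p x ^ n) \<in> coord_polys"
  by (induction n) (auto intro: coord_polys.intros)

lemma coord_polys_cnj: "p \<in> coord_polys \<Longrightarrow> (\<lambda>x. cnj (p x)) \<in> coord_polys"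
  by (induction rule: coord_polys.induct) (auto intro: coord_polys.intros)

lemma continuous_on_coord_polys: "p \<in> coord_polys \<Longrightarrow> continuous_on S p"
  by (induction rule: coord_polys.induct) (auto intro!: continuous_intros)

lemma tensor_poly_subset_coord_polys: "tensor_poly q \<subseteq> coord_polys"
proof
  fix p :: "'a \<Rightarrow> complex" assume "p \<in> tensor_poly q"
  then obtain c where p: "\<And>x. p x = (\<Sum>\<alpha>\<in>(\<Pi>\<^sub>E b\<in>Basis. {..q}).
      c \<alpha> * (\<Prod>b\<in>Basis. complex_of_real (x \<bullet> b) ^ \<alpha> b))"
    unfolding tensor_poly_def by blast
  show "p \<in> coord_polys"
    unfolding p[abs_def]
    by (intro coord_polys_sum coord_polys.mult coord_polys.const coord_polys_prod
        coord_polys_power coord_polys.coord)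
qed

text \<open>
  Differentiability is stated at every parameter \<open>s\<close> of the line \<open>t \<mapsto> x + t b\<close>, and not only at
  the base point, because the fundamental theorem of calculus is applied along whole lines.
\<close>

lemma coord_polys_derivative:
  assumes "p \<in> coord_polys"
  shows "\<exists>p'\<in>coord_polys. \<forall>x s. ((\<lambda>t. p (x + t *\<^sub>R b)) has_vector_derivative p' (x + s *\<^sub>R b)) (at s)"
  using assms
proof (induction rule: coord_polys.induct)
  case (const c)
  show ?case
    by (intro bexI[OF _ coord_polys.const[of 0]]) (auto intro: has_vector_derivative_const)
next
  case (coord c)
  have "((\<lambda>t. complex_of_real ((x + t *\<^sub>R b) \<bullet> c)) has_vector_derivative complex_of_real (b \<bullet> c)) (at s)"
    for x s
  proof -
    have "((\<lambda>t. (x + t *\<^sub>R b) \<bullet> c) has_real_derivative b \<bullet> c) (at s)"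
      by (auto intro!: derivative_eq_intros simp: inner_add_left)
    then show ?thesis
      by (intro bounded_linear.has_vector_derivative[OF bounded_linear_of_real])
        (simp add: has_real_derivative_iff_has_vector_derivative)
  qed
  then show ?case
    by (intro bexI[OF _ coord_polys.const[of "complex_of_real (b \<bullet> c)"]]) auto
next
  case (add p r)
  then obtain p' r' where *: "p' \<in> coord_polys" "r' \<in> coord_polys"
    "\<And>x s. ((\<lambda>t. p (x + t *\<^sub>R b)) has_vector_derivative p' (x + s *\<^sub>R b)) (at s)"
    "\<And>x s. ((\<lambda>t. r (x + t *\<^sub>R b)) has_vector_derivative r' (x + s *\<^sub>R b)) (at s)"
    by metis
  show ?case
    by (intro bexI[where x = "\<lambda>x. p' x + r' x"] allI has_vector_derivative_add *
        coord_polys.add)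
next
  case (mult p r)
  then obtain p' r' where *: "p' \<in> coord_polys" "r' \<in> coord_polys"
    "\<And>x s. ((\<lambda>t. p (x + t *\<^sub>R b)) has_vector_derivative p' (x + s *\<^sub>R b)) (at s)"
    "\<And>x s. ((\<lambda>t. r (x + t *\<^sub>R b)) has_vector_derivative r' (x + s *\<^sub>R b)) (at s)"
    by metis
  show ?case
    by (intro bexI[where x = "\<lambda>x. p x * r' x + p' x * r x"] allI has_vector_derivative_mult *
        coord_polys.add coord_polys.mult mult.hyps)
qed

lemma pderiv_dir_eqI:
  "((\<lambda>t. v (x + t *\<^sub>R b)) has_vector_derivative D) (at 0) \<Longrightarrow> pderiv_dir b v x = D"
  unfolding pderiv_dir_def by (rule vector_derivative_at)

lemma coord_polys_pderiv_dir: "p \<in> coord_polys \<Longrightarrow> pderiv_dir b p \<in> coord_polys"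
  and coord_polys_has_derivative:
    "p \<in> coord_polys \<Longrightarrow>
      ((\<lambda>t. p (x + t *\<^sub>R b)) has_vector_derivative pderiv_dir b p (x + s *\<^sub>R b)) (at s)"
proof -
  assume "p \<in> coord_polys"
  then obtain p' where p': "p' \<in> coord_polys"
    "\<And>x s. ((\<lambda>t. p (x + t *\<^sub>R b)) has_vector_derivative p' (x + s *\<^sub>R b)) (at s)"
    using coord_polys_derivative by blast
  have "pderiv_dir b p = p'"
    using p'(2)[of _ 0] by (intro ext pderiv_dir_eqI) simp
  with p' show "pderiv_dir b p \<in> coord_polys"
    "((\<lambda>t. p (x + t *\<^sub>R b)) has_vector_derivative pderiv_dir b p (x + s *\<^sub>R b)) (at s)"
    by auto
qed

section \<open>Piecewise polynomials on a Cartesian grid\<close>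

lemma mem_elem:
  "x \<in> elem X J \<longleftrightarrow> (\<forall>b\<in>Basis. X b (J b) < x \<bullet> b \<and> x \<bullet> b < X b (Suc (J b)))"
  by (auto simp: elem_def mem_box)

lemma open_elem: "open (elem X J)"
  unfolding elem_def by (rule open_box)

definition closed_elem :: "('a::euclidean_space \<Rightarrow> nat \<Rightarrow> real) \<Rightarrow> ('a \<Rightarrow> nat) \<Rightarrow> 'a set" where
  "closed_elem X J = cbox (\<Sum>b\<in>Basis. X b (J b) *\<^sub>R b) (\<Sum>b\<in>Basis. X b (Suc (J b)) *\<^sub>R b)"

lemma elem_subset_closed_elem: "elem X J \<subseteq> closed_elem X J"
  by (simp add: elem_def closed_elem_def box_subset_cbox)

lemma mem_closed_elem:
  "x \<in> closed_elem X J \<longleftrightarrow> (\<forall>b\<in>Basis. X b (J b) \<le> x \<bullet> b \<and> x \<bullet> b \<le> X b (Suc (J b)))"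
  by (auto simp: closed_elem_def mem_box)

lemma tensor_poly_lincomb:
  assumes "p \<in> tensor_poly q" "r \<in> tensor_poly q"
  shows "(\<lambda>x. c * p x + d * r x) \<in> tensor_poly q"
proof -
  obtain \<gamma> where p: "\<And>x. p x = (\<Sum>\<alpha>\<in>(\<Pi>\<^sub>E b\<in>Basis. {..q}). \<gamma> \<alpha> * (\<Prod>b\<in>Basis. complex_of_real (x \<bullet> b) ^ \<alpha> b))"
    using assms(1) unfolding tensor_poly_def by blast
  obtain \<delta> where r: "\<And>x. r x = (\<Sum>\<alpha>\<in>(\<Pi>\<^sub>E b\<in>Basis. {..q}). \<delta> \<alpha> * (\<Prod>b\<in>Basis. complex_of_real (x \<bullet> b) ^ \<alpha> b))"
    using assms(2) unfolding tensor_poly_def by blast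
  show ?thesis
    unfolding tensor_poly_def
    by (intro CollectI exI[of _ "\<lambda>\<alpha>. c * \<gamma> \<alpha> + d * \<delta> \<alpha>"])
      (simp add: p r sum_distrib_left sum.distrib distrib_right mult.assoc)
qed

lemma tensor_poly_cnj:
  assumes "p \<in> tensor_poly q"
  shows "(\<lambda>x. cnj (p x)) \<in> tensor_poly q"
proof -
  obtain \<gamma> where "\<And>x. p x = (\<Sum>\<alpha>\<in>(\<Pi>\<^sub>E b\<in>Basis. {..q}). \<gamma> \<alpha> * (\<Prod>b\<in>Basis. complex_of_real (x \<bullet> b) ^ \<alpha> b))"
    using assms unfolding tensor_poly_def by blast
  then show ?thesis
    unfolding tensor_poly_def
    by (intro CollectI exI[of _ "\<lambda>\<alpha>. cnj (\<gamma> \<alpha>)"]) simp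
qed

lemma dg_space_lincomb:
  assumes "v \<in> dg_space q N X" "w \<in> dg_space q N X"
  shows "(\<lambda>x. c * v x + d * w x) \<in> dg_space q N X"
  unfolding dg_space_def
proof (intro CollectI ballI)
  fix J assume "J \<in> cells N"
  with assms(1) obtain p where p: "p \<in> tensor_poly q" "\<forall>x\<in>elem X J. v x = p x"
    unfolding dg_space_def by blast
  from \<open>J \<in> cells N\<close> assms(2) obtain r where r: "r \<in> tensor_poly q" "\<forall>x\<in>elem X J. w x = r x"
    unfolding dg_space_def by blast
  from p r show "\<exists>p\<in>tensor_poly q. \<forall>x\<in>elem X J. c * v x + d * w x = p x"
    by (intro bexI[OF _ tensor_poly_lincomb[of p q r c d]]) auto
qed

lemma dg_space_cnj:
  assumes "v \<in> dg_space q N X"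
  shows "(\<lambda>x. cnj (v x)) \<in> dg_space q N X"
  unfolding dg_space_def
proof (intro CollectI ballI)
  fix J assume "J \<in> cells N"
  then obtain p where "p \<in> tensor_poly q" "\<And>x. x \<in> elem X J \<Longrightarrow> v x = p x"
    using assms unfolding dg_space_def by blast
  then show "\<exists>p\<in>tensor_poly q. \<forall>x\<in>elem X J. cnj (v x) = p x"
    by (intro bexI[OF _ tensor_poly_cnj[of p q]]) auto
qed

definition piecewise_polys ::
    "('a::euclidean_space \<Rightarrow> nat) \<Rightarrow> ('a \<Rightarrow> nat \<Rightarrow> real) \<Rightarrow> ('a \<Rightarrow> complex) set" where
  "piecewise_polys N X = {v. \<forall>J\<in>cells N. \<exists>p\<in>coord_polys. \<forall>x\<in>elem X J. v x = p x}"

lemma piecewise_polysE: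
  assumes "v \<in> piecewise_polys N X" "J \<in> cells N"
  obtains p where "p \<in> coord_polys" "\<And>x. x \<in> elem X J \<Longrightarrow> v x = p x"
  using assms unfolding piecewise_polys_def by blast

lemma dg_space_piecewise_polys: "v \<in> dg_space q N X \<Longrightarrow> v \<in> piecewise_polys N X"
  using tensor_poly_subset_coord_polys unfolding dg_space_def piecewise_polys_def by blast

lemma piecewise_polys_const: "(\<lambda>x. c) \<in> piecewise_polys N X"
  unfolding piecewise_polys_def using coord_polys.const[of c] by (intro CollectI ballI bexI) auto

lemma piecewise_polys_add:
  assumes "v \<in> piecewise_polys N X" "w \<in> piecewise_polys N X"
  shows "(\<lambda>x. v x + w x) \<in> piecewise_polys N X"
  unfolding piecewise_polys_def
proof (intro CollectI ballI)
  fix J assume J: "J \<in> cells N"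
  obtain p where p: "p \<in> coord_polys" "\<And>x. x \<in> elem X J \<Longrightarrow> v x = p x"
    using piecewise_polysE[OF assms(1) J] by blast
  obtain r where r: "r \<in> coord_polys" "\<And>x. x \<in> elem X J \<Longrightarrow> w x = r x"
    using piecewise_polysE[OF assms(2) J] by blast
  from p r show "\<exists>p\<in>coord_polys. \<forall>x\<in>elem X J. v x + w x = p x"
    by (intro bexI[OF _ coord_polys.add[OF p(1) r(1)]]) auto
qed

lemma piecewise_polys_mult:
  assumes "v \<in> piecewise_polys N X" "w \<in> piecewise_polys N X"
  shows "(\<lambda>x. v x * w x) \<in> piecewise_polys N X"
  unfolding piecewise_polys_def
proof (intro CollectI ballI)
  fix J assume J: "J \<in> cells N"
  obtain p where p: "p \<in> coord_polys" "\<And>x. x \<in> elem X J \<Longrightarrow> v x = p x"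
    using piecewise_polysE[OF assms(1) J] by blast
  obtain r where r: "r \<in> coord_polys" "\<And>x. x \<in> elem X J \<Longrightarrow> w x = r x"
    using piecewise_polysE[OF assms(2) J] by blast
  from p r show "\<exists>p\<in>coord_polys. \<forall>x\<in>elem X J. v x * w x = p x"
    by (intro bexI[OF _ coord_polys.mult[OF p(1) r(1)]]) auto
qed

lemma piecewise_polys_sum:
  "(\<And>i. i \<in> I \<Longrightarrow> v i \<in> piecewise_polys N X) \<Longrightarrow> (\<lambda>x. \<Sum>i\<in>I. v i x) \<in> piecewise_polys N X"
  by (induction I rule: infinite_finite_induct)
    (auto intro: piecewise_polys_const piecewise_polys_add)

lemma piecewise_polys_cnj:
  assumes "v \<in> piecewise_polys N X"
  shows "(\<lambda>x. cnj (v x)) \<in> piecewise_polys N X"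
  unfolding piecewise_polys_def
proof (intro CollectI ballI)
  fix J assume J: "J \<in> cells N"
  obtain p where p: "p \<in> coord_polys" "\<And>x. x \<in> elem X J \<Longrightarrow> v x = p x"
    using piecewise_polysE[OF assms(1) J] by blast
  from p show "\<exists>p\<in>coord_polys. \<forall>x\<in>elem X J. cnj (v x) = p x"
    by (intro bexI[OF _ coord_polys_cnj[OF p(1)]]) auto
qed

lemma piecewise_polys_scale:
  "v \<in> piecewise_polys N X \<Longrightarrow> (\<lambda>x. c * v x) \<in> piecewise_polys N X"
  by (intro piecewise_polys_mult piecewise_polys_const)

lemma piecewise_polys_diff:
  "v \<in> piecewise_polys N X \<Longrightarrow> w \<in> piecewise_polys N X \<Longrightarrow> (\<lambda>x. v x - w x) \<in> piecewise_polys N X"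
  using piecewise_polys_add[OF _ piecewise_polys_scale[of w N X "-1"], of v] by simp

text \<open>
  A function of the finite element space is known to be a polynomial only inside the open element.
  Since lines through a point of the element stay in it for a short while, this determines all
  derivatives there; iterating it requires the congruence for \<open>pderiv_dir\<close> below.
\<close>

lemma has_derivative_local_cong:
  assumes "\<And>x. x \<in> elem X J \<Longrightarrow> v x = p x" "x \<in> elem X J"
    and "((\<lambda>t. p (x + t *\<^sub>R b)) has_vector_derivative D) (at 0)"
  shows "((\<lambda>t. v (x + t *\<^sub>R b)) has_vector_derivative D) (at 0)"
proof (rule has_vector_derivative_transform_within_open[OF assms(3)])
  show "open ((\<lambda>t. x + t *\<^sub>R b) -` elem X J)"
    by (intro open_vimage open_elem continuous_intros)
qed (use assms in auto)

lemma pderiv_dir_local_cong: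
  assumes "\<And>x. x \<in> elem X J \<Longrightarrow> v x = p x" "x \<in> elem X J"
  shows "pderiv_dir b v x = pderiv_dir b p x"
proof -
  have "((\<lambda>t. v (x + t *\<^sub>R b)) has_vector_derivative D) (at 0) \<longleftrightarrow>
        ((\<lambda>t. p (x + t *\<^sub>R b)) has_vector_derivative D) (at 0)" for D
    using has_derivative_local_cong[of X J v p x b D] has_derivative_local_cong[of X J p v x b D]
      assms by auto
  then show ?thesis
    by (simp add: pderiv_dir_def vector_derivative_def)
qed

lemma piecewise_polys_pderiv_dir:
  assumes "v \<in> piecewise_polys N X"
  shows "pderiv_dir b v \<in> piecewise_polys N X"
  unfolding piecewise_polys_def
proof (intro CollectI ballI)
  fix J assume J: "J \<in> cells N"
  obtain p where p: "p \<in> coord_polys" "\<And>x. x \<in> elem X J \<Longrightarrow> v x = p x"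
    using piecewise_polysE[OF assms(1) J] by blast
  from p show "\<exists>p\<in>coord_polys. \<forall>x\<in>elem X J. pderiv_dir b v x = p x"
    by (intro bexI[OF _ coord_polys_pderiv_dir[OF p(1), of b]] ballI pderiv_dir_local_cong) auto
qed

lemma piecewise_polys_laplacian:
  "v \<in> piecewise_polys N X \<Longrightarrow> laplacian v \<in> piecewise_polys N X"
  unfolding laplacian_def[abs_def] by (intro piecewise_polys_sum piecewise_polys_pderiv_dir)

lemma piecewise_polys_has_derivative:
  assumes "v \<in> piecewise_polys N X" "J \<in> cells N" "x \<in> elem X J"
  shows "((\<lambda>t. v (x + t *\<^sub>R b)) has_vector_derivative pderiv_dir b v x) (at 0)"
proof -
  obtain p where p: "p \<in> coord_polys" "\<And>x. x \<in> elem X J \<Longrightarrow> v x = p x"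
    using piecewise_polysE[OF assms(1,2)] by blast
  have "pderiv_dir b v x = pderiv_dir b p x"
    using p(2) assms(3) by (rule pderiv_dir_local_cong)
  then show ?thesis
    using has_derivative_local_cong[OF p(2) assms(3)] coord_polys_has_derivative[OF p(1), of x b 0]
    by simp
qed

lemma pderiv_dir_cnj:
  assumes "v \<in> piecewise_polys N X" "J \<in> cells N" "x \<in> elem X J"
  shows "pderiv_dir b (\<lambda>x. cnj (v x)) x = cnj (pderiv_dir b v x)"
  by (intro pderiv_dir_eqI has_vector_derivative_cnj piecewise_polys_has_derivative[OF assms])

lemma pderiv_dir_lincomb:
  assumes "v \<in> piecewise_polys N X" "w \<in> piecewise_polys N X" "J \<in> cells N" "x \<in> elem X J"
  shows "pderiv_dir b (\<lambda>x. c * v x + d * w x) x = c * pderiv_dir b v x + d * pderiv_dir b w x"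
  by (intro pderiv_dir_eqI has_vector_derivative_add has_vector_derivative_mult_right
      piecewise_polys_has_derivative[OF assms(1,3,4)] piecewise_polys_has_derivative[OF assms(2-)])

lemma pderiv_dir_mult:
  assumes "v \<in> piecewise_polys N X" "w \<in> piecewise_polys N X" "J \<in> cells N" "x \<in> elem X J"
  shows "pderiv_dir b (\<lambda>x. v x * w x) x = v x * pderiv_dir b w x + pderiv_dir b v x * w x"
  using has_vector_derivative_mult[OF piecewise_polys_has_derivative[OF assms(1,3,4)]
      piecewise_polys_has_derivative[OF assms(2-)], of b]
  by (intro pderiv_dir_eqI) simp

lemma laplacian_cnj:
  assumes "v \<in> piecewise_polys N X" "J \<in> cells N" "x \<in> elem X J"
  shows "laplacian (\<lambda>x. cnj (v x)) x = cnj (laplacian v x)"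
proof -
  have "pderiv_dir b (pderiv_dir b (\<lambda>x. cnj (v x))) x = cnj (pderiv_dir b (pderiv_dir b v) x)" for b
  proof -
    have "pderiv_dir b (pderiv_dir b (\<lambda>x. cnj (v x))) x = pderiv_dir b (\<lambda>x. cnj (pderiv_dir b v x)) x"
      using pderiv_dir_cnj[OF assms(1,2)] assms(3) by (rule pderiv_dir_local_cong)
    also have "\<dots> = cnj (pderiv_dir b (pderiv_dir b v) x)"
      by (intro pderiv_dir_cnj[OF _ assms(2,3)] piecewise_polys_pderiv_dir assms)
    finally show ?thesis .
  qed
  then show ?thesis by (simp add: laplacian_def)
qed

lemma set_integrable_continuous_on_closed_elem:
  fixes f :: "'a::euclidean_space \<Rightarrow> 'b::{banach, second_countable_topology}"
  assumes "continuous_on (closed_elem X J) f"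
  shows "set_integrable lborel (elem X J) f"
proof (rule set_integrable_subset)
  show "set_integrable lborel (closed_elem X J) f"
    unfolding set_integrable_def
    using assms by (intro borel_integrable_compact) (auto simp: closed_elem_def)
qed (simp_all add: elem_subset_closed_elem, simp add: elem_def)

lemma set_integrable_piecewise_polys:
  assumes "v \<in> piecewise_polys N X" "J \<in> cells N"
  shows "set_integrable lborel (elem X J) v"
proof -
  obtain p where p: "p \<in> coord_polys" "\<And>x. x \<in> elem X J \<Longrightarrow> v x = p x"
    using piecewise_polysE[OF assms(1,2)] by blast
  have "set_integrable lborel (elem X J) p"
    by (intro set_integrable_continuous_on_closed_elem continuous_on_coord_polys p)
  then show ?thesis
    using p(2) by (simp cong: set_integrable_cong)
qed

section \<open>Faces and traces\<close>

definition face :: "('a::euclidean_space \<Rightarrow> nat \<Rightarrow> real) \<Rightarrow> ('a \<Rightarrow> nat) \<Rightarrow> 'a \<Rightarrow> ('a \<Rightarrow> real) set" where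
  "face X J b = (\<Pi>\<^sub>E c\<in>Basis - {b}. {X c (J c)<..<X c (Suc (J c))})"

abbreviation face_measure :: "'a::euclidean_space \<Rightarrow> ('a \<Rightarrow> real) measure" where
  "face_measure b \<equiv> (\<Pi>\<^sub>M c\<in>Basis - {b}. lborel)"

lemma face_integral_face: "face_integral X J b f = (LINT y:face X J b|face_measure b. f y)"
  by (simp add: face_integral_def face_def)

lemma face_cong: "(\<And>c. c \<noteq> b \<Longrightarrow> J c = L c) \<Longrightarrow> face X J b = face X L b"
  unfolding face_def by (intro PiE_cong) auto

lemma face_prev_cell: "face X (prev_cell N b J) b = face X J b"
  and face_next_cell: "face X (next_cell N b J) b = face X J b"
  by (auto intro!: face_cong simp: prev_cell_def next_cell_def)

interpretation lborel_product: product_sigma_finite "\<lambda>c::'a. lborel :: real measure" ..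

lemma face_sets [measurable]: "face X J b \<in> sets (face_measure b)"
  unfolding face_def by (rule sets_PiM_I_finite) auto

lemma emeasure_face_finite: "emeasure (face_measure b) (face X J b) < \<infinity>"
proof -
  have "emeasure (face_measure b) (face X J b) =
      (\<Prod>c\<in>Basis - {b}. emeasure lborel {X c (J c)<..<X c (Suc (J c))})"
    unfolding face_def by (rule lborel_product.emeasure_PiM) auto
  also have "\<dots> \<noteq> top"
    using emeasure_lborel_box_finite[where 'a = real]
    by (simp add: ennreal_prod_eq_top less_top flip: box_real)
  finally show ?thesis by (simp add: less_top)
qed

text \<open>
  The interface terms are products of traces from the two adjacent elements, which are not the trace
  of a single function.  Bounded measurable functions on a face are closed under products, and integrable since
  the face has finite measure.  A trace is described only on the face itself, whence the indicator.
\<close>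

definition face_bounded ::
    "('a::euclidean_space \<Rightarrow> nat \<Rightarrow> real) \<Rightarrow> ('a \<Rightarrow> nat) \<Rightarrow> 'a \<Rightarrow> (('a \<Rightarrow> real) \<Rightarrow> complex) \<Rightarrow> bool" where
  "face_bounded X J b f \<longleftrightarrow>
     (\<lambda>y. indicator (face X J b) y * f y) \<in> borel_measurable (face_measure b) \<and>
     (\<exists>C. \<forall>y\<in>face X J b. cmod (f y) \<le> C)"

lemma face_bounded_face_cong: "face X L b = face X J b \<Longrightarrow> face_bounded X L b = face_bounded X J b"
  by (simp add: face_bounded_def fun_eq_iff)

lemma face_bounded_mult:
  assumes "face_bounded X J b f" "face_bounded X J b g"
  shows "face_bounded X J b (\<lambda>y. f y * g y)"
proof -
  have [measurable]: "(\<lambda>y. indicator (face X J b) y * f y) \<in> borel_measurable (face_measure b)"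
    "(\<lambda>y. indicator (face X J b) y * g y) \<in> borel_measurable (face_measure b)"
    using assms by (auto simp: face_bounded_def)
  have "(\<lambda>y. (indicator (face X J b) y * f y) * (indicator (face X J b) y * g y))
      \<in> borel_measurable (face_measure b)"
    by measurable
  also have "(\<lambda>y. (indicator (face X J b) y * f y) * (indicator (face X J b) y * g y)) =
      (\<lambda>y. indicator (face X J b) y * (f y * g y))"
    by (auto simp: indicator_def)
  finally have m: "(\<lambda>y. indicator (face X J b) y * (f y * g y)) \<in> borel_measurable (face_measure b)" .
  obtain C D where "\<forall>y\<in>face X J b. cmod (f y) \<le> C" "\<forall>y\<in>face X J b. cmod (g y) \<le> D"
    using assms by (auto simp: face_bounded_def)
  then have "\<forall>y\<in>face X J b. cmod (f y * g y) \<le> C * D"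
    unfolding norm_mult by (meson mult_mono norm_ge_zero order_trans)
  with m show ?thesis by (auto simp: face_bounded_def)
qed

lemma face_bounded_integrable:
  assumes "face_bounded X J b f"
  shows "set_integrable (face_measure b) (face X J b) f"
proof -
  obtain C where C: "\<forall>y\<in>face X J b. cmod (f y) \<le> C"
    using assms by (auto simp: face_bounded_def)
  have "integrable (face_measure b)
      (\<lambda>y. indicator (face X J b) y *\<^sub>R (indicator (face X J b) y * f y))"
    using assms C
    by (intro integrableI_bounded_set_indicator[where B = C] emeasure_face_finite AE_I2)
      (auto simp: face_bounded_def)
  also have "(\<lambda>y. indicator (face X J b) y *\<^sub>R (indicator (face X J b) y * f y)) =
      (\<lambda>y. indicator (face X J b) y *\<^sub>R f y)"
    by (auto simp: indicator_def)
  finally show ?thesis by (simp add: set_integrable_def)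
qed

lemma face_integral_cong:
  "(\<And>y. y \<in> face X J b \<Longrightarrow> f y = g y) \<Longrightarrow> face_integral X J b f = face_integral X J b g"
  unfolding face_integral_face by (intro set_lebesgue_integral_cong) auto

lemma face_integral_lincomb:
  assumes "face_bounded X J b f" "face_bounded X J b g"
  shows "face_integral X J b (\<lambda>y. c * f y + d * g y) =
    c * face_integral X J b f + d * face_integral X J b g"
  unfolding face_integral_face using assms
  by (simp add: set_integral_add face_bounded_integrable)

lemma face_integral_diff:
  assumes "face_bounded X J b f" "face_bounded X J b g"
  shows "face_integral X J b (\<lambda>y. f y - g y) = face_integral X J b f - face_integral X J b g"
  using face_integral_lincomb[OF assms, of 1 "-1"] by simp

lemma face_integral_cnj:
  "face_integral X J b (\<lambda>y. cnj (f y)) = cnj (face_integral X J b f)"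
  unfolding face_integral_face by (rule set_integral_cnj)

lemma face_integral_neighbours:
  "face_integral X (prev_cell N b J) b f = face_integral X J b f"
  "face_integral X (next_cell N b J) b f = face_integral X J b f"
  unfolding face_integral_face face_prev_cell face_next_cell by simp_all

lemma inner_face_point:
  "b \<in> Basis \<Longrightarrow> c \<in> Basis \<Longrightarrow> face_point b s y \<bullet> c = (if c = b then s else y c)"
  by (auto simp: face_point_def inner_add_left inner_sum_left inner_Basis sum.delta'
      if_distrib[of "\<lambda>z. _ * z"] cong: if_cong)

text \<open>
  The traces from both ends of an element, with the position \<open>s\<close> of the face as parameter, so that
  each property is proved once for the two of them.
\<close>

definition trace ::
    "('a::euclidean_space \<Rightarrow> nat \<Rightarrow> real) \<Rightarrow> ('a \<Rightarrow> nat) \<Rightarrow> 'a \<Rightarrow> real \<Rightarrow> ('a \<Rightarrow> complex) \<Rightarrow> ('a \<Rightarrow> real) \<Rightarrow> complex" where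
  "trace X J b s v y = Lim (at (face_point b s y) within elem X J) v"

lemma upper_trace_eq: "upper_trace X J b = trace X J b (X b (Suc (J b)))"
  and lower_trace_eq: "lower_trace X J b = trace X J b (X b (J b))"
  by (simp_all add: fun_eq_iff upper_trace_def lower_trace_def trace_def)

locale cartesian_grid =
  fixes N :: "'a::euclidean_space \<Rightarrow> nat" and X :: "'a \<Rightarrow> nat \<Rightarrow> real"
  assumes N_pos: "b \<in> Basis \<Longrightarrow> 0 < N b"
    and nodes_increasing: "b \<in> Basis \<Longrightarrow> j < N b \<Longrightarrow> X b j < X b (Suc j)"
begin

lemma cells_bound: "J \<in> cells N \<Longrightarrow> b \<in> Basis \<Longrightarrow> J b < N b"
  by (auto simp: cells_def)

lemma prev_cell_mem: "J \<in> cells N \<Longrightarrow> b \<in> Basis \<Longrightarrow> prev_cell N b J \<in> cells N"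
  and next_cell_mem: "J \<in> cells N \<Longrightarrow> b \<in> Basis \<Longrightarrow> next_cell N b J \<in> cells N"
  using N_pos by (auto simp: cells_def prev_cell_def next_cell_def PiE_iff extensional_def)

lemma next_prev_cell:
  assumes "J \<in> cells N" "b \<in> Basis"
  shows "next_cell N b (prev_cell N b J) = J"
proof -
  have "Suc ((J b + N b - 1) mod N b) mod N b = J b"
    using cells_bound[OF assms] by (simp add: mod_Suc_eq)
  then show ?thesis by (auto simp: next_cell_def prev_cell_def)
qed

lemma prev_next_cell:
  assumes "J \<in> cells N" "b \<in> Basis"
  shows "prev_cell N b (next_cell N b J) = J"
proof -
  have "(Suc (J b) mod N b + N b - Suc 0) mod N b = J b"
  proof (cases "Suc (J b) = N b")
    case False
    with cells_bound[OF assms] have "Suc (J b) mod N b = Suc (J b)" by simp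
    then show ?thesis using cells_bound[OF assms] by simp
  qed (use cells_bound[OF assms] in auto)
  then show ?thesis by (auto simp: next_cell_def prev_cell_def)
qed

lemma bij_prev_cell: "b \<in> Basis \<Longrightarrow> bij_betw (prev_cell N b) (cells N) (cells N)"
  by (rule bij_betwI[where g = "next_cell N b"])
    (auto simp: prev_cell_mem next_cell_mem next_prev_cell prev_next_cell)

abbreviation sides :: "('a \<Rightarrow> nat) \<Rightarrow> 'a \<Rightarrow> real set" where
  "sides J b \<equiv> {X b (J b), X b (Suc (J b))}"

lemma face_point_closed_elem:
  assumes "J \<in> cells N" "b \<in> Basis" "s \<in> sides J b" "y \<in> face X J b"
  shows "face_point b s y \<in> closed_elem X J"
  using assms nodes_increasing[OF assms(2) cells_bound[OF assms(1,2)]]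
  by (auto simp: mem_closed_elem inner_face_point face_def PiE_iff less_imp_le)

text \<open>
  \<open>Lim\<close> is determined only at limit points of the element.  A point over the relative interior of a
  face lies in the closed element but not in the open one, so it is one.
\<close>

lemma face_point_limit:
  assumes J: "J \<in> cells N" and b: "b \<in> Basis" and s: "s \<in> sides J b" and y: "y \<in> face X J b"
  shows "at (face_point b s y) within elem X J \<noteq> bot"
proof -
  have "elem X J \<noteq> {}"
    using nodes_increasing cells_bound[OF J] by (simp add: elem_def box_ne_empty)
  then have "closure (elem X J) = closed_elem X J"
    unfolding elem_def closed_elem_def by (rule closure_box)
  with face_point_closed_elem[OF assms] have "face_point b s y \<in> closure (elem X J)"
    by simp
  moreover have "face_point b s y \<notin> elem X J"
    using b s by (auto simp: mem_elem inner_face_point intro!: bexI[of _ b])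
  ultimately show ?thesis
    by (simp add: closure_def trivial_limit_within)
qed

text \<open>
  A polynomial is continuous up to the boundary, so the trace is its value there.  The algebraic rules
  for traces follow by choosing polynomials for the functions involved.
\<close>

lemma trace_eqI:
  assumes "J \<in> cells N" "b \<in> Basis" "s \<in> sides J b" "y \<in> face X J b"
    and p: "p \<in> coord_polys" "\<And>x. x \<in> elem X J \<Longrightarrow> v x = p x"
  shows "trace X J b s v y = p (face_point b s y)"
  unfolding trace_def
proof (rule tendsto_Lim)
  let ?F = "at (face_point b s y) within elem X J"
  show "\<not> trivial_limit ?F"
    using face_point_limit[OF assms(1-4)] .
  have "(p \<longlongrightarrow> p (face_point b s y)) ?F"
    using continuous_on_coord_polys[OF p(1), of UNIV]
    by (auto simp: continuous_on_def intro: tendsto_within_subset[where S = UNIV])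
  then show "(v \<longlongrightarrow> p (face_point b s y)) ?F"
    by (rule Lim_transform_eventually) (auto simp: eventually_at_filter p(2))
qed

lemma trace_cong:
  assumes "v \<in> piecewise_polys N X"
    and "J \<in> cells N" "b \<in> Basis" "s \<in> sides J b" "y \<in> face X J b"
    and "\<And>x. x \<in> elem X J \<Longrightarrow> v x = w x"
  shows "trace X J b s v y = trace X J b s w y"
proof -
  obtain p where p: "p \<in> coord_polys" "\<And>x. x \<in> elem X J \<Longrightarrow> v x = p x"
    using piecewise_polysE[OF assms(1,2)] by blast
  have "trace X J b s v y = p (face_point b s y)" "trace X J b s w y = p (face_point b s y)"
    using assms(6) p(2) by (intro trace_eqI[OF assms(2-5) p(1)]; simp)+
  then show ?thesis by simp
qed

lemma trace_mult:
  assumes "v \<in> piecewise_polys N X" "w \<in> piecewise_polys N X"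
    and "J \<in> cells N" "b \<in> Basis" "s \<in> sides J b" "y \<in> face X J b"
  shows "trace X J b s (\<lambda>x. v x * w x) y = trace X J b s v y * trace X J b s w y"
proof -
  obtain p where p: "p \<in> coord_polys" "\<And>x. x \<in> elem X J \<Longrightarrow> v x = p x"
    using piecewise_polysE[OF assms(1,3)] by blast
  obtain r where r: "r \<in> coord_polys" "\<And>x. x \<in> elem X J \<Longrightarrow> w x = r x"
    using piecewise_polysE[OF assms(2,3)] by blast
  have "trace X J b s (\<lambda>x. v x * w x) y = p (face_point b s y) * r (face_point b s y)"
    using trace_eqI[OF assms(3-6) coord_polys.mult[OF p(1) r(1)], of "\<lambda>x. v x * w x"] p(2) r(2)
    by auto
  then show ?thesis
    using trace_eqI[OF assms(3-6) p] trace_eqI[OF assms(3-6) r] by simp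
qed

lemma trace_lincomb:
  assumes "v \<in> piecewise_polys N X" "w \<in> piecewise_polys N X"
    and "J \<in> cells N" "b \<in> Basis" "s \<in> sides J b" "y \<in> face X J b"
  shows "trace X J b s (\<lambda>x. c * v x + d * w x) y = c * trace X J b s v y + d * trace X J b s w y"
proof -
  obtain p where p: "p \<in> coord_polys" "\<And>x. x \<in> elem X J \<Longrightarrow> v x = p x"
    using piecewise_polysE[OF assms(1,3)] by blast
  obtain r where r: "r \<in> coord_polys" "\<And>x. x \<in> elem X J \<Longrightarrow> w x = r x"
    using piecewise_polysE[OF assms(2,3)] by blast
  have "(\<lambda>x. c * p x + d * r x) \<in> coord_polys"
    by (intro coord_polys.intros p r)
  from trace_eqI[OF assms(3-6) this, of "\<lambda>x. c * v x + d * w x"]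
  have "trace X J b s (\<lambda>x. c * v x + d * w x) y =
      c * p (face_point b s y) + d * r (face_point b s y)"
    using p(2) r(2) by auto
  then show ?thesis
    using trace_eqI[OF assms(3-6) p] trace_eqI[OF assms(3-6) r] by simp
qed

lemma trace_cnj:
  assumes "v \<in> piecewise_polys N X"
    and "J \<in> cells N" "b \<in> Basis" "s \<in> sides J b" "y \<in> face X J b"
  shows "trace X J b s (\<lambda>x. cnj (v x)) y = cnj (trace X J b s v y)"
proof -
  obtain p where p: "p \<in> coord_polys" "\<And>x. x \<in> elem X J \<Longrightarrow> v x = p x"
    using piecewise_polysE[OF assms(1,2)] by blast
  show ?thesis
    using trace_eqI[OF assms(2-5) coord_polys_cnj[OF p(1)], of "\<lambda>x. cnj (v x)"] p(2)
      trace_eqI[OF assms(2-5) p] by simp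
qed

lemma trace_pderiv_lincomb:
  assumes v: "v \<in> piecewise_polys N X" and w: "w \<in> piecewise_polys N X"
    and f: "J \<in> cells N" "b \<in> Basis" "s \<in> sides J b" "y \<in> face X J b"
  shows "trace X J b s (pderiv_dir e (\<lambda>x. c * v x + d * w x)) y =
    c * trace X J b s (pderiv_dir e v) y + d * trace X J b s (pderiv_dir e w) y"
proof -
  have "trace X J b s (pderiv_dir e (\<lambda>x. c * v x + d * w x)) y =
      trace X J b s (\<lambda>x. c * pderiv_dir e v x + d * pderiv_dir e w x) y"
    by (intro trace_cong f pderiv_dir_lincomb[OF v w f(1)] piecewise_polys_pderiv_dir
        piecewise_polys_add piecewise_polys_scale v w)
  then show ?thesis
    by (simp add: trace_lincomb[OF piecewise_polys_pderiv_dir[OF v] piecewise_polys_pderiv_dir[OF w] f])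
qed

lemma trace_pderiv_cnj:
  assumes v: "v \<in> piecewise_polys N X"
    and f: "J \<in> cells N" "b \<in> Basis" "s \<in> sides J b" "y \<in> face X J b"
  shows "trace X J b s (pderiv_dir e (\<lambda>x. cnj (v x))) y = cnj (trace X J b s (pderiv_dir e v) y)"
proof -
  have "trace X J b s (pderiv_dir e (\<lambda>x. cnj (v x))) y = trace X J b s (\<lambda>x. cnj (pderiv_dir e v x)) y"
    by (intro trace_cong f pderiv_dir_cnj[OF v f(1)] piecewise_polys_pderiv_dir
        piecewise_polys_cnj v)
  then show ?thesis
    by (simp add: trace_cnj[OF piecewise_polys_pderiv_dir[OF v] f])
qed

lemma measurable_face_point:
  "(\<lambda>y. face_point b s y) \<in> measurable (face_measure b) borel"
  unfolding face_point_def by measurable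

lemma face_bounded_trace:
  assumes v: "v \<in> piecewise_polys N X" and J: "J \<in> cells N" and b: "b \<in> Basis" and s: "s \<in> sides J b"
  shows "face_bounded X J b (trace X J b s v)"
proof -
  obtain p where p: "p \<in> coord_polys" "\<And>x. x \<in> elem X J \<Longrightarrow> v x = p x"
    using piecewise_polysE[OF v J] by blast
  note eq = trace_eqI[OF J b s _ p]
  have [measurable]: "(\<lambda>y. p (face_point b s y)) \<in> borel_measurable (face_measure b)"
    by (rule measurable_compose[OF measurable_face_point borel_measurable_continuous_onI])
      (rule continuous_on_coord_polys[OF p(1)])
  have "(\<lambda>y. indicator (face X J b) y * p (face_point b s y)) \<in> borel_measurable (face_measure b)"
    by measurable
  also have "(\<lambda>y. indicator (face X J b) y * p (face_point b s y)) =
      (\<lambda>y. indicator (face X J b) y * trace X J b s v y)"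
    using eq by (auto simp: indicator_def)
  finally have m: "(\<lambda>y. indicator (face X J b) y * trace X J b s v y) \<in> borel_measurable (face_measure b)" .
  have "compact (p ` closed_elem X J)"
    by (intro compact_continuous_image continuous_on_coord_polys p) (simp add: closed_elem_def)
  then obtain C where "\<forall>z\<in>p ` closed_elem X J. cmod z \<le> C"
    using compact_imp_bounded bounded_iff by blast
  then have "\<forall>y\<in>face X J b. cmod (trace X J b s v y) \<le> C"
    using eq face_point_closed_elem[OF J b s] by auto
  with m show ?thesis by (auto simp: face_bounded_def)
qed

section \<open>Green's identity on an element\<close>

text \<open>
  Fubini's theorem separates the coordinate along \<open>b\<close> from those on the face, and the fundamental
  theorem of calculus evaluates the inner integral at the two ends of the element.
\<close>

lemma divergence_elem:
  assumes v: "v \<in> piecewise_polys N X" and J: "J \<in> cells N" and b: "b \<in> Basis"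
  shows "(LINT x:elem X J|lborel. pderiv_dir b v x) =
    face_integral X J b (upper_trace X J b v) - face_integral X J b (lower_trace X J b v)"
proof -
  obtain p where p: "p \<in> coord_polys" "\<And>x. x \<in> elem X J \<Longrightarrow> v x = p x"
    using piecewise_polysE[OF v J] by blast
  define l where "l = X b (J b)"
  define r where "r = X b (Suc (J b))"
  have lr: "l < r"
    using nodes_increasing[OF b cells_bound[OF J b]] by (simp add: l_def r_def)
  define f where "f x = indicator (elem X J) x *\<^sub>R pderiv_dir b p x" for x
  define P where "P z = (\<Sum>c\<in>Basis. z c *\<^sub>R c)" for z :: "'a \<Rightarrow> real"
  have Pm: "P \<in> measurable (\<Pi>\<^sub>M c\<in>Basis. lborel) borel"
    unfolding P_def by measurable
  have ins: "insert b (Basis - {b}) = Basis"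
    using b by auto
  have f_int: "integrable lborel f"
    using set_integrable_continuous_on_closed_elem[OF
        continuous_on_coord_polys[OF coord_polys_pderiv_dir[OF p(1)]]]
    by (simp add: f_def[abs_def] set_integrable_def)
  then have fm: "f \<in> borel_measurable borel" by auto
  have dist: "(lborel :: 'a measure) = distr (\<Pi>\<^sub>M c\<in>Basis. lborel) borel P"
    unfolding P_def by (rule lborel_eq)
  have int': "integrable (\<Pi>\<^sub>M c\<in>insert b (Basis - {b}). lborel) (\<lambda>z. f (P z))"
    using f_int unfolding ins by (subst (asm) dist) (simp add: integrable_distr_eq[OF Pm fm])
  have "(LINT x:elem X J|lborel. pderiv_dir b v x) = integral\<^sup>L lborel f"
    unfolding set_lebesgue_integral_def f_def
    by (intro Bochner_Integration.integral_cong)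
      (auto simp: indicator_def intro!: pderiv_dir_local_cong[OF p(2)])
  also have "\<dots> = (LINT z|(\<Pi>\<^sub>M c\<in>insert b (Basis - {b}). lborel). f (P z))"
    unfolding ins by (subst dist) (simp add: integral_distr[OF Pm fm])
  also have "\<dots> = (LINT y|face_measure b. LINT s|lborel. f (P (y(b := s))))"
    by (intro lborel_product.product_integral_insert int') auto
  also have "\<dots> = (LINT y:face X J b|face_measure b.
      upper_trace X J b v y - lower_trace X J b v y)"
    unfolding set_lebesgue_integral_def
  proof (intro Bochner_Integration.integral_cong refl)
    fix y :: "'a \<Rightarrow> real" assume "y \<in> space (face_measure b)"
    then have ext: "y \<in> extensional (Basis - {b})"
      by (auto simp: space_PiM PiE_iff)
    have P_eq: "P (y(b := s)) = face_point b s y" for s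
      unfolding P_def face_point_def using b by (simp add: sum.remove[of _ b])
    have ind: "indicator (elem X J) (face_point b s y) =
        (indicator (face X J b) y * indicator {l<..<r} s :: real)" for s
      using b ext
      by (auto simp: indicator_def mem_elem inner_face_point face_def PiE_iff l_def r_def
          split: if_splits)
    have line: "face_point b s y = (\<Sum>c\<in>Basis - {b}. y c *\<^sub>R c) + s *\<^sub>R b" for s
      by (simp add: face_point_def)
    have FTC: "(LINT s:{l<..<r}|lborel. pderiv_dir b p (face_point b s y)) =
        p (face_point b r y) - p (face_point b l y)"
    proof -
      have "(LBINT s=ereal l..ereal r. pderiv_dir b p (face_point b s y)) =
          p (face_point b r y) - p (face_point b l y)"
      proof (rule interval_integral_FTC_finite)
        show "continuous_on {min l r..max l r} (\<lambda>s. pderiv_dir b p (face_point b s y))"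
          unfolding line
          by (intro continuous_on_compose2[OF continuous_on_coord_polys[OF
                  coord_polys_pderiv_dir[OF p(1)], of UNIV]] continuous_intros) auto
        show "((\<lambda>s. p (face_point b s y)) has_vector_derivative pderiv_dir b p (face_point b s y))
            (at s within {min l r..max l r})" for s
          unfolding line
          by (rule has_vector_derivative_at_within) (rule coord_polys_has_derivative[OF p(1)])
      qed
      then show ?thesis
        using lr by (simp add: interval_lebesgue_integral_def)
    qed
    have "(LINT s|lborel. f (P (y(b := s)))) =
        indicator (face X J b) y *\<^sub>R (LINT s:{l<..<r}|lborel. pderiv_dir b p (face_point b s y))"
      unfolding set_lebesgue_integral_def f_def P_eq ind
      by (simp flip: scaleR_scaleR)
    also have "\<dots> = indicator (face X J b) y *\<^sub>R
        (upper_trace X J b v y - lower_trace X J b v y)"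
    proof (cases "y \<in> face X J b")
      case True
      then have "upper_trace X J b v y = p (face_point b r y)"
          "lower_trace X J b v y = p (face_point b l y)"
        unfolding upper_trace_eq lower_trace_eq l_def r_def
        by (intro trace_eqI J b p; simp)+
      then show ?thesis by (simp add: FTC)
    qed simp
    finally show "(LINT s|lborel. f (P (y(b := s)))) = indicator (face X J b) y *\<^sub>R
        (upper_trace X J b v y - lower_trace X J b v y)" .
  qed
  also have "\<dots> = face_integral X J b (\<lambda>y. upper_trace X J b v y - lower_trace X J b v y)"
    by (simp add: face_integral_face)
  also have "\<dots> = face_integral X J b (upper_trace X J b v) - face_integral X J b (lower_trace X J b v)"
    unfolding upper_trace_eq lower_trace_eq
    by (intro face_integral_diff face_bounded_trace v J b) auto
  finally show ?thesis .
qed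

end

section \<open>The two numerical Laplacians\<close>

text \<open>
  The ultra-weak discretisations of \<open>\<integral>\<^sub>K (\<Delta> u) \<psi>\<close> in the two equations of the scheme, with fluxes from
  the right (or top) and from the left (or bottom), respectively.
\<close>

definition plus_form ::
    "('a::euclidean_space \<Rightarrow> nat) \<Rightarrow> ('a \<Rightarrow> nat \<Rightarrow> real) \<Rightarrow> ('a \<Rightarrow> nat)
      \<Rightarrow> ('a \<Rightarrow> complex) \<Rightarrow> ('a \<Rightarrow> complex) \<Rightarrow> complex" where
  "plus_form N X J u \<psi> =
     (LINT x:elem X J|lborel. u x * laplacian \<psi> x)
       + boundary_integral N X J (flux_grad_u N X u) (\<lambda>b. \<psi>)
       - boundary_integral N X J (flux_u N X u) (\<lambda>b. pderiv_dir b \<psi>)"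

definition minus_form ::
    "('a::euclidean_space \<Rightarrow> nat) \<Rightarrow> ('a \<Rightarrow> nat \<Rightarrow> real) \<Rightarrow> ('a \<Rightarrow> nat)
      \<Rightarrow> ('a \<Rightarrow> complex) \<Rightarrow> ('a \<Rightarrow> complex) \<Rightarrow> complex" where
  "minus_form N X J w \<phi> =
     (LINT x:elem X J|lborel. w x * laplacian \<phi> x)
       + boundary_integral N X J (flux_grad_w X w) (\<lambda>b. \<phi>)
       - boundary_integral N X J (flux_w X w) (\<lambda>b. pderiv_dir b \<phi>)"

context cartesian_grid
begin

text \<open>
  Divergence theorem for the field with components \<open>v \<partial>\<^sub>b w - w \<partial>\<^sub>b v\<close>: in its divergence the products
  of first derivatives cancel, and the Laplacians remain.
\<close>

lemma green_elem:
  assumes v: "v \<in> piecewise_polys N X" and w: "w \<in> piecewise_polys N X" and J: "J \<in> cells N"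
  shows "(LINT x:elem X J|lborel. v x * laplacian w x) - (LINT x:elem X J|lborel. w x * laplacian v x) =
    (\<Sum>b\<in>Basis.
        (face_integral X J b (\<lambda>y. upper_trace X J b v y * upper_trace X J b (pderiv_dir b w) y)
       - face_integral X J b (\<lambda>y. upper_trace X J b w y * upper_trace X J b (pderiv_dir b v) y))
      - (face_integral X J b (\<lambda>y. lower_trace X J b v y * lower_trace X J b (pderiv_dir b w) y)
       - face_integral X J b (\<lambda>y. lower_trace X J b w y * lower_trace X J b (pderiv_dir b v) y)))"
proof -
  note pp = piecewise_polys_mult piecewise_polys_diff piecewise_polys_pderiv_dir
    piecewise_polys_laplacian piecewise_polys_sum v w
  define g where "g b x = v x * pderiv_dir b w x - w x * pderiv_dir b v x" for b x
  have g: "g b \<in> piecewise_polys N X" for b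
    unfolding g_def[abs_def] by (intro pp)
  have flux: "face_integral X J b (trace X J b s (g b)) =
      face_integral X J b (\<lambda>y. trace X J b s v y * trace X J b s (pderiv_dir b w) y)
    - face_integral X J b (\<lambda>y. trace X J b s w y * trace X J b s (pderiv_dir b v) y)"
    if b: "b \<in> Basis" and s: "s \<in> sides J b" for b s
  proof -
    have "face_integral X J b (trace X J b s (g b)) =
        face_integral X J b (\<lambda>y. trace X J b s v y * trace X J b s (pderiv_dir b w) y
          - trace X J b s w y * trace X J b s (pderiv_dir b v) y)"
    proof (rule face_integral_cong)
      fix y assume y: "y \<in> face X J b"
      have "trace X J b s (g b) y = trace X J b s (\<lambda>x. v x * pderiv_dir b w x) y
          - trace X J b s (\<lambda>x. w x * pderiv_dir b v x) y"
        using trace_lincomb[of "\<lambda>x. v x * pderiv_dir b w x" "\<lambda>x. w x * pderiv_dir b v x"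
            J b s y 1 "-1"] J b s y
        by (simp add: g_def[abs_def] pp)
      then show "trace X J b s (g b) y = trace X J b s v y * trace X J b s (pderiv_dir b w) y
          - trace X J b s w y * trace X J b s (pderiv_dir b v) y"
        by (simp add: trace_mult[OF _ _ J b s y] pp)
    qed
    then show ?thesis
      by (simp add: face_integral_diff face_bounded_mult face_bounded_trace[OF _ J b s] pp)
  qed
  have "(LINT x:elem X J|lborel. v x * laplacian w x) - (LINT x:elem X J|lborel. w x * laplacian v x) =
      (LINT x:elem X J|lborel. v x * laplacian w x - w x * laplacian v x)"
    by (rule set_integral_diff(2)[symmetric]; intro set_integrable_piecewise_polys[OF _ J] pp)
  also have "\<dots> = (LINT x:elem X J|lborel. \<Sum>b\<in>Basis. pderiv_dir b (g b) x)"
  proof (rule set_lebesgue_integral_cong)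
    show "\<forall>x. x \<in> elem X J \<longrightarrow>
        v x * laplacian w x - w x * laplacian v x = (\<Sum>b\<in>Basis. pderiv_dir b (g b) x)"
    proof (intro allI impI)
      fix x assume x: "x \<in> elem X J"
      have "pderiv_dir b (g b) x =
          v x * pderiv_dir b (pderiv_dir b w) x - w x * pderiv_dir b (pderiv_dir b v) x" for b
        using pderiv_dir_lincomb[where b = b and c = 1 and d = "-1",
            OF piecewise_polys_mult[OF v piecewise_polys_pderiv_dir[OF w]]
            piecewise_polys_mult[OF w piecewise_polys_pderiv_dir[OF v]] J x]
          pderiv_dir_mult[OF v piecewise_polys_pderiv_dir[OF w] J x]
          pderiv_dir_mult[OF w piecewise_polys_pderiv_dir[OF v] J x]
        by (simp add: g_def[abs_def])
      then show "v x * laplacian w x - w x * laplacian v x = (\<Sum>b\<in>Basis. pderiv_dir b (g b) x)"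
        by (simp add: laplacian_def sum_distrib_left sum_subtractf)
    qed
  qed (simp add: elem_def)
  also have "\<dots> = (\<Sum>b\<in>Basis. LINT x:elem X J|lborel. pderiv_dir b (g b) x)"
    using set_integrable_piecewise_polys[OF piecewise_polys_pderiv_dir[OF g] J]
    unfolding set_lebesgue_integral_def set_integrable_def scaleR_sum_right
    by (intro Bochner_Integration.integral_sum)
  also have "\<dots> = (\<Sum>b\<in>Basis. face_integral X J b (upper_trace X J b (g b))
      - face_integral X J b (lower_trace X J b (g b)))"
    by (intro sum.cong refl divergence_elem g J)
  finally show ?thesis
    unfolding upper_trace_eq lower_trace_eq by (simp add: flux cong: sum.cong)
qed

text \<open>
  The alternating choice of fluxes makes the two forms transposes of each other.  After Green's identity
  the difference on element \<open>J\<close> is, for each direction \<open>b\<close>, an expression \<open>R b J\<close> on its upper face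
  minus the same expression on its lower face, which is the upper face of the periodic predecessor.
\<close>

lemma minus_form_adjoint_plus_form:
  assumes v: "v \<in> piecewise_polys N X" and w: "w \<in> piecewise_polys N X"
  shows "(\<Sum>J\<in>cells N. minus_form N X J w v) = (\<Sum>J\<in>cells N. plus_form N X J v w)"
proof -
  \<comment> \<open>Interface term on the upper face of \<open>J\<close>: \<open>v\<^sup>+ \<partial>\<^sub>b w\<^sup>- - \<partial>\<^sub>b v\<^sup>+ w\<^sup>-\<close>.\<close>
  define R where "R b J =
      face_integral X J b (\<lambda>y. lower_trace X (next_cell N b J) b v y * upper_trace X J b (pderiv_dir b w) y)
    - face_integral X J b (\<lambda>y. lower_trace X (next_cell N b J) b (pderiv_dir b v) y * upper_trace X J b w y)"
    for b J
  have R_prev: "R b (prev_cell N b J) =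
      face_integral X J b (\<lambda>y. lower_trace X J b v y * upper_trace X (prev_cell N b J) b (pderiv_dir b w) y)
    - face_integral X J b (\<lambda>y. lower_trace X J b (pderiv_dir b v) y * upper_trace X (prev_cell N b J) b w y)"
    if "J \<in> cells N" "b \<in> Basis" for b J
    by (simp add: R_def face_integral_neighbours next_prev_cell[OF that])
  have "minus_form N X J w v - plus_form N X J v w = (\<Sum>b\<in>Basis. R b J - R b (prev_cell N b J))"
    if J: "J \<in> cells N" for J
  proof -
    have "minus_form N X J w v - plus_form N X J v w =
      ((LINT x:elem X J|lborel. w x * laplacian v x) - (LINT x:elem X J|lborel. v x * laplacian w x))
      + (boundary_integral N X J (flux_grad_w X w) (\<lambda>b. v)
        - boundary_integral N X J (flux_w X w) (\<lambda>b. pderiv_dir b v)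
        - boundary_integral N X J (flux_grad_u N X v) (\<lambda>b. w)
        + boundary_integral N X J (flux_u N X v) (\<lambda>b. pderiv_dir b w))"
      by (simp add: minus_form_def plus_form_def)
    also have "\<dots> = (\<Sum>b\<in>Basis. R b J - R b (prev_cell N b J))"
      unfolding green_elem[OF w v J] boundary_integral_def flux_u_def flux_grad_u_def flux_w_def
        flux_grad_w_def minus_trace_def plus_trace_def
        sum_subtractf[symmetric] sum.distrib[symmetric]
    by (intro sum.cong refl) (simp add: R_prev[OF J] next_prev_cell[OF J], simp add: R_def algebra_simps)
    finally show ?thesis .
  qed
  then have "(\<Sum>J\<in>cells N. minus_form N X J w v) - (\<Sum>J\<in>cells N. plus_form N X J v w) =
      (\<Sum>J\<in>cells N. \<Sum>b\<in>Basis. R b J - R b (prev_cell N b J))"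
    by (simp flip: sum_subtractf)
  also have "\<dots> = (\<Sum>b\<in>Basis. (\<Sum>J\<in>cells N. R b J) - (\<Sum>J\<in>cells N. R b (prev_cell N b J)))"
    by (subst sum.swap) (simp add: sum_subtractf)
  also have "\<dots> = 0"
  proof (intro sum.neutral ballI)
    fix b :: 'a assume "b \<in> Basis"
    then show "(\<Sum>J\<in>cells N. R b J) - (\<Sum>J\<in>cells N. R b (prev_cell N b J)) = 0"
      using sum.reindex_bij_betw[OF bij_prev_cell, of b "R b"] by simp
  qed
  finally show ?thesis by simp
qed

end

section \<open>Numerical Laplacians of test functions\<close>

text \<open>
  A pair that satisfies the second equation of the scheme.  This is the property of \<open>u\<^sup>n\<^sup>\<plusminus>\<^sup>1\<close>
  and \<open>w\<^sup>n\<^sup>\<plusminus>\<^sup>1\<close> that carries over to the test functions built from \<open>u\<^sup>n\<^sup>\<plusminus>\<^sup>1\<close>.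
\<close>

definition numerical_laplacian ::
    "nat \<Rightarrow> ('a::euclidean_space \<Rightarrow> nat) \<Rightarrow> ('a \<Rightarrow> nat \<Rightarrow> real) \<Rightarrow> ('a \<Rightarrow> complex) \<Rightarrow> ('a \<Rightarrow> complex) \<Rightarrow> bool" where
  "numerical_laplacian q N X u \<omega> \<longleftrightarrow> u \<in> dg_space q N X \<and> \<omega> \<in> dg_space q N X \<and>
     (\<forall>J\<in>cells N. \<forall>\<psi>\<in>dg_space q N X. second_eq N X J u \<omega> \<psi>)"

context cartesian_grid
begin

lemma second_eq_iff:
  assumes "u \<in> piecewise_polys N X" "w \<in> piecewise_polys N X" "\<psi> \<in> piecewise_polys N X" "J \<in> cells N"
  shows "second_eq N X J u w \<psi> \<longleftrightarrow> (LINT x:elem X J|lborel. w x * \<psi> x) = plus_form N X J u \<psi>"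
proof -
  have *: "(LINT x:elem X J|lborel. w x * \<psi> x - u x * laplacian \<psi> x) =
      (LINT x:elem X J|lborel. w x * \<psi> x) - (LINT x:elem X J|lborel. u x * laplacian \<psi> x)"
    by (rule set_integral_diff(2); intro set_integrable_piecewise_polys[OF _ assms(4)]
        piecewise_polys_mult piecewise_polys_laplacian assms)
  show ?thesis
    unfolding second_eq_def plus_form_def * by (auto simp: algebra_simps)
qed

lemma boundary_integral_lincomb:
  assumes J: "J \<in> cells N" and T: "\<And>b. b \<in> Basis \<Longrightarrow> T b \<in> piecewise_polys N X"
    and g: "\<And>b L y. b \<in> Basis \<Longrightarrow> L \<in> cells N \<Longrightarrow> y \<in> face X L b \<Longrightarrow>
      g b L y = c * g1 b L y + d * g2 b L y"
    and bd: "\<And>b L. b \<in> Basis \<Longrightarrow> L \<in> cells N \<Longrightarrow> face_bounded X L b (g1 b L)"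
      "\<And>b L. b \<in> Basis \<Longrightarrow> L \<in> cells N \<Longrightarrow> face_bounded X L b (g2 b L)"
  shows "boundary_integral N X J g T =
    c * boundary_integral N X J g1 T + d * boundary_integral N X J g2 T"
proof -
  have side: "face_integral X J b (\<lambda>y. g b L y * trace X J b s (T b) y) =
      c * face_integral X J b (\<lambda>y. g1 b L y * trace X J b s (T b) y) +
      d * face_integral X J b (\<lambda>y. g2 b L y * trace X J b s (T b) y)"
    if b: "b \<in> Basis" and s: "s \<in> sides J b" and L: "L \<in> cells N" "face X L b = face X J b" for b s L
  proof -
    have "face_integral X J b (\<lambda>y. g b L y * trace X J b s (T b) y) =
      face_integral X J b (\<lambda>y. c * (g1 b L y * trace X J b s (T b) y)
        + d * (g2 b L y * trace X J b s (T b) y))"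
      using g[OF b L(1)] L(2) by (intro face_integral_cong) (simp add: algebra_simps)
    also have "\<dots> = c * face_integral X J b (\<lambda>y. g1 b L y * trace X J b s (T b) y) +
      d * face_integral X J b (\<lambda>y. g2 b L y * trace X J b s (T b) y)"
      using bd[OF b L(1)] unfolding face_bounded_face_cong[OF L(2)]
      by (intro face_integral_lincomb face_bounded_mult face_bounded_trace T J b s)
    finally show ?thesis .
  qed
  show ?thesis
    unfolding boundary_integral_def upper_trace_eq lower_trace_eq
    by (simp add: side J prev_cell_mem face_prev_cell sum_distrib_left algebra_simps
        flip: sum.distrib sum_subtractf cong: sum.cong)
qed

lemma boundary_integral_cnj:
  assumes J: "J \<in> cells N"
    and T: "\<And>b s y. b \<in> Basis \<Longrightarrow> s \<in> sides J b \<Longrightarrow> y \<in> face X J b \<Longrightarrow>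
      trace X J b s (T b) y = cnj (trace X J b s (T' b) y)"
    and g: "\<And>b L y. b \<in> Basis \<Longrightarrow> L \<in> cells N \<Longrightarrow> y \<in> face X L b \<Longrightarrow> g b L y = cnj (g' b L y)"
  shows "boundary_integral N X J g T = cnj (boundary_integral N X J g' T')"
proof -
  have side: "face_integral X J b (\<lambda>y. g b L y * trace X J b s (T b) y) =
      cnj (face_integral X J b (\<lambda>y. g' b L y * trace X J b s (T' b) y))"
    if b: "b \<in> Basis" and s: "s \<in> sides J b" and L: "L \<in> cells N" "face X L b = face X J b" for b s L
  proof -
    have "face_integral X J b (\<lambda>y. g b L y * trace X J b s (T b) y) =
        face_integral X J b (\<lambda>y. cnj (g' b L y * trace X J b s (T' b) y))"
      using g[OF b L(1)] L(2) T[OF b s] by (intro face_integral_cong) simp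
    then show ?thesis by (simp only: face_integral_cnj)
  qed
  show ?thesis
    unfolding boundary_integral_def upper_trace_eq lower_trace_eq
    by (simp add: side J prev_cell_mem face_prev_cell cong: sum.cong)
qed

lemma face_bounded_flux_u:
  assumes "u \<in> piecewise_polys N X" "b \<in> Basis" "L \<in> cells N"
  shows "face_bounded X L b (flux_u N X u b L)"
    and "face_bounded X L b (flux_grad_u N X u b L)"
  using face_bounded_trace[OF assms(1) next_cell_mem[OF assms(3,2)] assms(2)]
    face_bounded_trace[OF piecewise_polys_pderiv_dir[OF assms(1)] next_cell_mem[OF assms(3,2)] assms(2)]
  unfolding flux_u_def[abs_def] flux_grad_u_def[abs_def] plus_trace_def lower_trace_eq
    face_bounded_face_cong[OF face_next_cell]
  by auto

lemma plus_form_lincomb: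
  assumes u: "u \<in> piecewise_polys N X" and v: "v \<in> piecewise_polys N X"
    and \<psi>: "\<psi> \<in> piecewise_polys N X" and J: "J \<in> cells N"
  shows "plus_form N X J (\<lambda>x. c * u x + d * v x) \<psi> = c * plus_form N X J u \<psi> + d * plus_form N X J v \<psi>"
proof -
  have int: "set_integrable lborel (elem X J) (\<lambda>x. z x * laplacian \<psi> x)"
    if "z \<in> piecewise_polys N X" for z
    by (intro set_integrable_piecewise_polys[OF _ J] piecewise_polys_mult
        piecewise_polys_laplacian \<psi> that)
  have "(LINT x:elem X J|lborel. (c * u x + d * v x) * laplacian \<psi> x) =
      (LINT x:elem X J|lborel. c * (u x * laplacian \<psi> x) + d * (v x * laplacian \<psi> x))"
    by (simp add: algebra_simps)
  also have "\<dots> = c * (LINT x:elem X J|lborel. u x * laplacian \<psi> x)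
      + d * (LINT x:elem X J|lborel. v x * laplacian \<psi> x)"
    using int[OF u] int[OF v] by (simp add: set_integral_add)
  finally have vol: "(LINT x:elem X J|lborel. (c * u x + d * v x) * laplacian \<psi> x) =
      c * (LINT x:elem X J|lborel. u x * laplacian \<psi> x)
      + d * (LINT x:elem X J|lborel. v x * laplacian \<psi> x)" .
  have "boundary_integral N X J (flux_u N X (\<lambda>x. c * u x + d * v x)) (\<lambda>b. pderiv_dir b \<psi>) =
      c * boundary_integral N X J (flux_u N X u) (\<lambda>b. pderiv_dir b \<psi>)
      + d * boundary_integral N X J (flux_u N X v) (\<lambda>b. pderiv_dir b \<psi>)"
    by (intro boundary_integral_lincomb J face_bounded_flux_u piecewise_polys_pderiv_dir \<psi> u v)
      (simp add: flux_u_def plus_trace_def lower_trace_eq trace_lincomb[OF u v] next_cell_mem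
        face_next_cell)
  moreover have "boundary_integral N X J (flux_grad_u N X (\<lambda>x. c * u x + d * v x)) (\<lambda>b. \<psi>) =
      c * boundary_integral N X J (flux_grad_u N X u) (\<lambda>b. \<psi>)
      + d * boundary_integral N X J (flux_grad_u N X v) (\<lambda>b. \<psi>)"
    by (intro boundary_integral_lincomb J face_bounded_flux_u piecewise_polys_pderiv_dir \<psi> u v)
      (simp add: flux_grad_u_def plus_trace_def lower_trace_eq trace_pderiv_lincomb[OF u v]
        next_cell_mem face_next_cell)
  ultimately show ?thesis
    unfolding plus_form_def vol by (simp add: algebra_simps)
qed

text \<open>
  Test functions enter the scheme without conjugation, so conjugating the trial function amounts to
  conjugating the test function and the value of the form.
\<close>

lemma plus_form_cnj:
  assumes u: "u \<in> piecewise_polys N X" and \<psi>: "\<psi> \<in> piecewise_polys N X" and J: "J \<in> cells N"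
  shows "plus_form N X J (\<lambda>x. cnj (u x)) \<psi> = cnj (plus_form N X J u (\<lambda>x. cnj (\<psi> x)))"
proof -
  have "(LINT x:elem X J|lborel. cnj (u x) * laplacian \<psi> x) =
      (LINT x:elem X J|lborel. cnj (u x * laplacian (\<lambda>x. cnj (\<psi> x)) x))"
    by (rule set_lebesgue_integral_cong) (auto simp: elem_def laplacian_cnj[OF \<psi> J])
  then have vol: "(LINT x:elem X J|lborel. cnj (u x) * laplacian \<psi> x) =
      cnj (LINT x:elem X J|lborel. u x * laplacian (\<lambda>x. cnj (\<psi> x)) x)"
    by (simp only: set_integral_cnj)
  have "boundary_integral N X J (flux_u N X (\<lambda>x. cnj (u x))) (\<lambda>b. pderiv_dir b \<psi>) =
      cnj (boundary_integral N X J (flux_u N X u) (\<lambda>b. pderiv_dir b (\<lambda>x. cnj (\<psi> x))))"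
    by (intro boundary_integral_cnj J)
      (simp_all add: flux_u_def plus_trace_def lower_trace_eq trace_cnj[OF u] trace_pderiv_cnj[OF \<psi>]
        J next_cell_mem face_next_cell)
  moreover have "boundary_integral N X J (flux_grad_u N X (\<lambda>x. cnj (u x))) (\<lambda>b. \<psi>) =
      cnj (boundary_integral N X J (flux_grad_u N X u) (\<lambda>b. \<lambda>x. cnj (\<psi> x)))"
    by (intro boundary_integral_cnj J)
      (simp_all add: flux_grad_u_def plus_trace_def lower_trace_eq trace_pderiv_cnj[OF u]
        trace_cnj[OF \<psi>] J next_cell_mem face_next_cell)
  ultimately show ?thesis
    by (simp add: plus_form_def vol)
qed

lemma numerical_laplacian_lincomb:
  assumes "numerical_laplacian q N X u \<omega>" "numerical_laplacian q N X v \<eta>"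
  shows "numerical_laplacian q N X (\<lambda>x. c * u x + d * v x) (\<lambda>x. c * \<omega> x + d * \<eta> x)"
proof -
  have dg: "u \<in> dg_space q N X" "\<omega> \<in> dg_space q N X" "v \<in> dg_space q N X" "\<eta> \<in> dg_space q N X"
    using assms by (auto simp: numerical_laplacian_def)
  note pp = dg[THEN dg_space_piecewise_polys]
  show ?thesis
    unfolding numerical_laplacian_def
  proof (intro conjI ballI dg_space_lincomb dg)
    fix J \<psi> assume J: "J \<in> cells N" and \<psi>: "\<psi> \<in> dg_space q N X"
    note \<psi>' = dg_space_piecewise_polys[OF \<psi>]
    have int: "set_integrable lborel (elem X J) (\<lambda>x. z x * \<psi> x)" if "z \<in> piecewise_polys N X" for z
      by (intro set_integrable_piecewise_polys[OF _ J] piecewise_polys_mult \<psi>' that)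
    have "(LINT x:elem X J|lborel. (c * \<omega> x + d * \<eta> x) * \<psi> x) =
        (LINT x:elem X J|lborel. c * (\<omega> x * \<psi> x) + d * (\<eta> x * \<psi> x))"
      by (simp add: algebra_simps)
    also have "\<dots> = c * (LINT x:elem X J|lborel. \<omega> x * \<psi> x) + d * (LINT x:elem X J|lborel. \<eta> x * \<psi> x)"
      using int[OF pp(2)] int[OF pp(4)] by (simp add: set_integral_add)
    also have "\<dots> = c * plus_form N X J u \<psi> + d * plus_form N X J v \<psi>"
      using assms J \<psi> second_eq_iff[OF pp(1,2) \<psi>' J] second_eq_iff[OF pp(3,4) \<psi>' J]
      by (simp add: numerical_laplacian_def)
    finally show "second_eq N X J (\<lambda>x. c * u x + d * v x) (\<lambda>x. c * \<omega> x + d * \<eta> x) \<psi>"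
      using dg_space_piecewise_polys[OF dg_space_lincomb[OF dg(1,3)]] dg_space_piecewise_polys[OF dg_space_lincomb[OF dg(2,4)]]
      by (simp add: second_eq_iff \<psi>' J plus_form_lincomb pp)
  qed
qed

lemma numerical_laplacian_cnj:
  assumes "numerical_laplacian q N X u \<omega>"
  shows "numerical_laplacian q N X (\<lambda>x. cnj (u x)) (\<lambda>x. cnj (\<omega> x))"
proof -
  have dg: "u \<in> dg_space q N X" "\<omega> \<in> dg_space q N X"
    using assms by (auto simp: numerical_laplacian_def)
  note pp = dg[THEN dg_space_piecewise_polys]
  show ?thesis
    unfolding numerical_laplacian_def
  proof (intro conjI ballI dg_space_cnj dg)
    fix J \<psi> assume J: "J \<in> cells N" and \<psi>: "\<psi> \<in> dg_space q N X"
    have "(LINT x:elem X J|lborel. cnj (\<omega> x) * \<psi> x) =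
        (LINT x:elem X J|lborel. cnj (\<omega> x * cnj (\<psi> x)))"
      by simp
    also have "\<dots> = cnj (LINT x:elem X J|lborel. \<omega> x * cnj (\<psi> x))"
      by (rule set_integral_cnj)
    also have "\<dots> = cnj (plus_form N X J u (\<lambda>x. cnj (\<psi> x)))"
      using assms J dg_space_cnj[OF \<psi>] second_eq_iff[OF pp dg_space_piecewise_polys[OF dg_space_cnj[OF \<psi>]] J]
      by (simp add: numerical_laplacian_def)
    finally show "second_eq N X J (\<lambda>x. cnj (u x)) (\<lambda>x. cnj (\<omega> x)) \<psi>"
      using second_eq_iff[OF pp[THEN piecewise_polys_cnj] dg_space_piecewise_polys[OF \<psi>] J]
      by (simp add: plus_form_cnj[OF pp(1) dg_space_piecewise_polys[OF \<psi>] J])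
  qed
qed

text \<open>
  Duality: transposition moves \<open>\<phi>\<close> to the trial slot of the other form, where the second equation
  with test function \<open>w\<close> applies.
\<close>

lemma minus_form_numerical_laplacian:
  assumes "numerical_laplacian q N X \<phi> \<omega>" and w: "w \<in> dg_space q N X"
  shows "(\<Sum>J\<in>cells N. minus_form N X J w \<phi>) = (\<Sum>J\<in>cells N. LINT x:elem X J|lborel. w x * \<omega> x)"
proof -
  have dg: "\<phi> \<in> dg_space q N X" "\<omega> \<in> dg_space q N X"
    using assms by (auto simp: numerical_laplacian_def)
  note pp = dg[THEN dg_space_piecewise_polys]
  have "(\<Sum>J\<in>cells N. minus_form N X J w \<phi>) = (\<Sum>J\<in>cells N. plus_form N X J \<phi> w)"
    by (rule minus_form_adjoint_plus_form[OF pp(1) dg_space_piecewise_polys[OF w]])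
  also have "\<dots> = (\<Sum>J\<in>cells N. LINT x:elem X J|lborel. w x * \<omega> x)"
  proof (rule sum.cong[OF refl])
    fix J assume J: "J \<in> cells N"
    then show "plus_form N X J \<phi> w = (LINT x:elem X J|lborel. w x * \<omega> x)"
      using assms second_eq_iff[OF pp dg_space_piecewise_polys[OF w] J]
      by (simp add: numerical_laplacian_def mult.commute)
  qed
  finally show ?thesis .
qed

lemma boundary_integral_flux_cong:
  assumes J: "J \<in> cells N"
    and g: "\<And>b L y. b \<in> Basis \<Longrightarrow> L \<in> cells N \<Longrightarrow> y \<in> face X L b \<Longrightarrow> g b L y = g' b L y"
  shows "boundary_integral N X J g T = boundary_integral N X J g' T"
  unfolding boundary_integral_def
  using g[OF _ J] g[OF _ prev_cell_mem[OF J]]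
  by (intro sum.cong arg_cong2[where f = "(-)"] face_integral_cong refl) (auto simp: face_prev_cell)

text \<open>
  The first equation averages numerical fluxes.  Traces of piecewise polynomials are linear, so this is
  the flux of the average.
\<close>

lemma boundary_integral_average:
  assumes w: "w (n + 1) \<in> piecewise_polys N X" "w (n - 1) \<in> piecewise_polys N X" and J: "J \<in> cells N"
  shows "boundary_integral N X J (\<lambda>b L y. tavg (\<lambda>m. flux_w X (w m) b L y) n) T =
      boundary_integral N X J (flux_w X (\<lambda>x. tavg (\<lambda>m. w m x) n)) T"
    and "boundary_integral N X J (\<lambda>b L y. tavg (\<lambda>m. flux_grad_w X (w m) b L y) n) T =
      boundary_integral N X J (flux_grad_w X (\<lambda>x. tavg (\<lambda>m. w m x) n)) T"
proof -
  have avg: "tavg f n = (1/2) * f (n + 1) + (1/2) * f (n - 1)" for f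
    by (simp add: tavg_def add_divide_distrib)
  show "boundary_integral N X J (\<lambda>b L y. tavg (\<lambda>m. flux_w X (w m) b L y) n) T =
      boundary_integral N X J (flux_w X (\<lambda>x. tavg (\<lambda>m. w m x) n)) T"
    unfolding avg flux_w_def minus_trace_def upper_trace_eq
    by (intro boundary_integral_flux_cong J trace_lincomb[OF w, symmetric]) auto
  show "boundary_integral N X J (\<lambda>b L y. tavg (\<lambda>m. flux_grad_w X (w m) b L y) n) T =
      boundary_integral N X J (flux_grad_w X (\<lambda>x. tavg (\<lambda>m. w m x) n)) T"
    unfolding avg flux_grad_w_def minus_trace_def upper_trace_eq
    by (intro boundary_integral_flux_cong J trace_pderiv_lincomb[OF w, symmetric]) auto
qed

section \<open>Conservation of mass and energy\<close>

text \<open>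
  The sum of the first equation over all elements is \<open>\<integral> i \<delta>u \<phi> + U \<G> \<phi>\<close> plus \<open>B\<^sup>-(W, \<phi>)\<close>, and
  duality replaces this form by \<open>\<integral> W \<omega>\<close>.
\<close>

lemma scheme_tested_numerical_laplacian:
  assumes scheme: "cn_ldg_solution F F' h Nt q N X u w" and n: "1 \<le> n" "n \<le> Nt - 1"
    and \<omega>: "numerical_laplacian q N X \<phi> \<omega>"
  defines "f \<equiv> \<lambda>x. \<i> * tdiff h (\<lambda>m. u m x) n * \<phi> x + tavg (\<lambda>m. w m x) n * \<omega> x
     + tavg (\<lambda>m. u m x) n
         * complex_of_real (diff_quot F F' ((cmod (u (n + 1) x))\<^sup>2) ((cmod (u (n - 1) x))\<^sup>2)) * \<phi> x"
  shows "J \<in> cells N \<Longrightarrow> set_integrable lborel (elem X J) f"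
    and "(\<Sum>J\<in>cells N. LINT x:elem X J|lborel. f x) = 0"
proof -
  have \<phi>: "\<phi> \<in> dg_space q N X" and \<omega>_dg: "\<omega> \<in> dg_space q N X"
    using \<omega> by (auto simp: numerical_laplacian_def)
  have w_dg: "w (n + 1) \<in> dg_space q N X" "w (n - 1) \<in> dg_space q N X"
    using scheme n by (auto simp: cn_ldg_solution_def)
  define W where "W x = tavg (\<lambda>m. w m x) n" for x
  have W: "W \<in> dg_space q N X"
    using dg_space_lincomb[OF w_dg, of "1/2" "1/2"]
    by (simp add: W_def[abs_def] tavg_def add_divide_distrib)
  \<comment> \<open>The term with \<open>\<Delta> \<phi>\<close> is split off to be absorbed, with the boundary terms, in \<open>minus_form\<close>.\<close>
  have f: "f = (\<lambda>x. first_eq_integrand F F' h u w n \<phi> x - W x * laplacian \<phi> x + W x * \<omega> x)"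
    by (simp add: f_def first_eq_integrand_def W_def fun_eq_iff)
  have int: "set_integrable lborel (elem X J) (first_eq_integrand F F' h u w n \<phi>)"
    and eq: "(LINT x:elem X J|lborel. first_eq_integrand F F' h u w n \<phi> x) =
      - boundary_integral N X J (flux_grad_w X W) (\<lambda>b. \<phi>)
      + boundary_integral N X J (flux_w X W) (\<lambda>b. pderiv_dir b \<phi>)"
    if J: "J \<in> cells N" for J
    using scheme n J \<phi> unfolding W_def[abs_def] boundary_integral_average[OF w_dg[THEN dg_space_piecewise_polys] J, symmetric]
    by (auto simp: cn_ldg_solution_def)
  have int_lap: "set_integrable lborel (elem X J) (\<lambda>x. W x * laplacian \<phi> x)"
    and int_\<omega>: "set_integrable lborel (elem X J) (\<lambda>x. W x * \<omega> x)" if J: "J \<in> cells N" for J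
    by (intro set_integrable_piecewise_polys[OF _ J] piecewise_polys_mult piecewise_polys_laplacian
        dg_space_piecewise_polys[OF W] dg_space_piecewise_polys[OF \<phi>] dg_space_piecewise_polys[OF \<omega>_dg])+
  show "set_integrable lborel (elem X J) f" if J: "J \<in> cells N" for J
    unfolding f using int[OF J] int_lap[OF J] int_\<omega>[OF J] by simp
  have "(LINT x:elem X J|lborel. f x) =
      (LINT x:elem X J|lborel. W x * \<omega> x) - minus_form N X J W \<phi>" if J: "J \<in> cells N" for J
    unfolding f using int[OF J] int_lap[OF J] int_\<omega>[OF J]
    by (simp add: set_integral_add set_integral_diff eq[OF J] minus_form_def)
  then show "(\<Sum>J\<in>cells N. LINT x:elem X J|lborel. f x) = 0"
    by (simp add: sum_subtractf minus_form_numerical_laplacian[OF \<omega> W])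
qed

text \<open>
  On each element the integrand extends continuously to the compact closure, where \<open>|v|\<^sup>2\<close> stays in
  the half-line on which \<open>g\<close> is continuous.  With \<open>g = F\<close> this makes the energy density integrable.
\<close>

lemma set_integrable_comp_cmod_sq:
  fixes g :: "real \<Rightarrow> real"
  assumes v: "v \<in> piecewise_polys N X" and J: "J \<in> cells N" and g: "continuous_on {0..} g"
  shows "set_integrable lborel (elem X J) (\<lambda>x. g ((cmod (v x))\<^sup>2))"
proof -
  obtain p where p: "p \<in> coord_polys" "\<And>x. x \<in> elem X J \<Longrightarrow> v x = p x"
    using piecewise_polysE[OF v J] by blast
  have "set_integrable lborel (elem X J) (\<lambda>x. g ((cmod (p x))\<^sup>2))"
    by (intro set_integrable_continuous_on_closed_elem continuous_on_compose2[OF g]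
        continuous_intros continuous_on_coord_polys p) auto
  then show ?thesis
    using p(2) by (simp cong: set_integrable_cong)
qed

end

lemma Re_mean_times_difference:
  "Re ((a + b) / 2 * cnj (a - b)) = ((cmod a)\<^sup>2 - (cmod b)\<^sup>2) / 2"
  unfolding cmod_power2 by (simp add: power2_eq_square field_simps)

theorem theorem3:
  fixes lo hi :: "'a::euclidean_space"
    and N :: "'a \<Rightarrow> nat" and X :: "'a \<Rightarrow> nat \<Rightarrow> real"
    and t :: "nat \<Rightarrow> real" and h T :: real and Nt q :: nat
    and F F' :: "real \<Rightarrow> real"
    and u w :: "nat \<Rightarrow> 'a \<Rightarrow> complex"
  assumes dim: "DIM('a) = 1 \<or> DIM('a) = 2"
    and mesh: "cartesian_mesh lo hi N X"
    and grid: "uniform_time_grid t h Nt T"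
    and F_deriv: "\<And>s. 0 \<le> s \<Longrightarrow> (F has_real_derivative F' s) (at s within {0..})"
    and F_nonneg: "\<And>s. 0 \<le> s \<Longrightarrow> 0 \<le> F s"
    and q: "1 \<le> q"
    and scheme: "cn_ldg_solution F F' h Nt q N X u w"
  shows "\<forall>n. 1 \<le> n \<and> n \<le> Nt - 1 \<longrightarrow>
           discrete_mass N X u (n + 1) = discrete_mass N X u n \<and>
           discrete_hamiltonian F N X u w (n + 1) = discrete_hamiltonian F N X u w n"
proof (intro allI impI)
  fix n assume n: "1 \<le> n \<and> n \<le> Nt - 1"
  interpret cartesian_grid N X
    using mesh by unfold_locales (auto simp: cartesian_mesh_def)
  have h: "h > 0"
  proof -
    have "n < Nt" using n by linarith
    then have "t n < t (Suc n)" "h = t (Suc n) - t n"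
      using grid by (auto simp: uniform_time_grid_def)
    then show ?thesis by simp
  qed
  have F_cont: "continuous_on {0..} F"
    using F_deriv by (intro DERIV_continuous_on) auto
  have dg: "u m \<in> dg_space q N X" "w m \<in> dg_space q N X" if "m \<le> n + 1" for m
    using scheme n that by (auto simp: cn_ldg_solution_def)
  have sq_int: "set_integrable lborel (elem X J) (\<lambda>x. (cmod (v x))\<^sup>2)"
    if "v \<in> dg_space q N X" "J \<in> cells N" for v J
    using set_integrable_comp_cmod_sq[OF dg_space_piecewise_polys that(2), of v q "\<lambda>s. s"] that(1) by auto
  have F_int: "set_integrable lborel (elem X J) (\<lambda>x. F ((cmod (v x))\<^sup>2))"
    if "v \<in> dg_space q N X" "J \<in> cells N" for v J
    using set_integrable_comp_cmod_sq[OF dg_space_piecewise_polys that(2) F_cont] that(1) by auto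
  have lap: "numerical_laplacian q N X (u (n + 1)) (w (n + 1))"
      "numerical_laplacian q N X (u (n - 1)) (w (n - 1))"
    using scheme n dg by (auto simp: numerical_laplacian_def cn_ldg_solution_def)
  define G where "G x = diff_quot F F' ((cmod (u (n + 1) x))\<^sup>2) ((cmod (u (n - 1) x))\<^sup>2)" for x
  \<comment> \<open>Where the two moduli agree, both sides vanish.\<close>
  have G: "((cmod (u (n + 1) x))\<^sup>2 - (cmod (u (n - 1) x))\<^sup>2) * G x =
      F ((cmod (u (n + 1) x))\<^sup>2) - F ((cmod (u (n - 1) x))\<^sup>2)" for x
    by (simp add: G_def diff_quot_def)
  note tested = scheme_tested_numerical_laplacian[OF scheme conjunct1[OF n] conjunct2[OF n], folded G_def]

  have "(\<Sum>J\<in>cells N. LINT x:elem X J|lborel. (cmod (u (n + 1) x))\<^sup>2 - (cmod (u (n - 1) x))\<^sup>2) = 0"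
  proof -
    have "numerical_laplacian q N X (\<lambda>x. cnj (tavg (\<lambda>m. u m x) n)) (\<lambda>x. cnj (tavg (\<lambda>m. w m x) n))"
      using numerical_laplacian_cnj[OF numerical_laplacian_lincomb[OF lap, of "1/2" "1/2"]]
      by (simp add: tavg_def add_divide_distrib)
    note t = tested[OF this]
    \<comment> \<open>\<open>W\<close> times its conjugate and \<open>U \<G>\<close> times the conjugate of \<open>U\<close> are real.\<close>
    have Im_eq: "Im (\<i> * tdiff h (\<lambda>m. u m x) n * cnj (tavg (\<lambda>m. u m x) n)
        + tavg (\<lambda>m. w m x) n * cnj (tavg (\<lambda>m. w m x) n)
        + tavg (\<lambda>m. u m x) n * complex_of_real (G x) * cnj (tavg (\<lambda>m. u m x) n)) =
      1 / (4 * h) * ((cmod (u (n + 1) x))\<^sup>2 - (cmod (u (n - 1) x))\<^sup>2)" for x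
      using h unfolding tdiff_def tavg_def cmod_power2 by (simp add: power2_eq_square field_simps)
    have "0 = Im (\<Sum>J\<in>cells N. LINT x:elem X J|lborel.
        \<i> * tdiff h (\<lambda>m. u m x) n * cnj (tavg (\<lambda>m. u m x) n)
        + tavg (\<lambda>m. w m x) n * cnj (tavg (\<lambda>m. w m x) n)
        + tavg (\<lambda>m. u m x) n * complex_of_real (G x) * cnj (tavg (\<lambda>m. u m x) n))"
      using t(2) by simp
    also have "\<dots> = (\<Sum>J\<in>cells N. LINT x:elem X J|lborel.
        1 / (4 * h) * ((cmod (u (n + 1) x))\<^sup>2 - (cmod (u (n - 1) x))\<^sup>2))"
      unfolding Im_sum by (intro sum.cong refl) (simp only: set_integral_Im[OF t(1)] Im_eq)
    also have "\<dots> = 1 / (4 * h) *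
        (\<Sum>J\<in>cells N. LINT x:elem X J|lborel. (cmod (u (n + 1) x))\<^sup>2 - (cmod (u (n - 1) x))\<^sup>2)"
      by (simp only: set_integral_mult_right sum_distrib_left)
    finally show ?thesis using h by simp
  qed
  then have mass: "(\<Sum>J\<in>cells N. LINT x:elem X J|lborel. (cmod (u (n + 1) x))\<^sup>2) =
      (\<Sum>J\<in>cells N. LINT x:elem X J|lborel. (cmod (u (n - 1) x))\<^sup>2)"
    using sq_int[OF dg(1)] by (simp add: set_integral_diff sum_subtractf)

  have "(\<Sum>J\<in>cells N. LINT x:elem X J|lborel.
      ((cmod (w (n + 1) x))\<^sup>2 + F ((cmod (u (n + 1) x))\<^sup>2))
      - ((cmod (w (n - 1) x))\<^sup>2 + F ((cmod (u (n - 1) x))\<^sup>2))) = 0"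
  proof -
    have "numerical_laplacian q N X (\<lambda>x. cnj (u (n + 1) x - u (n - 1) x))
        (\<lambda>x. cnj (w (n + 1) x - w (n - 1) x))"
      using numerical_laplacian_cnj[OF numerical_laplacian_lincomb[OF lap, of 1 "-1"]] by simp
    note t = tested[OF this]
    \<comment> \<open>Without the factor \<open>1 / 2h\<close> of \<open>\<delta>u\<close> in the test function, the increments appear undivided.\<close>
    have Re_eq: "Re (\<i> * tdiff h (\<lambda>m. u m x) n * cnj (u (n + 1) x - u (n - 1) x)
        + tavg (\<lambda>m. w m x) n * cnj (w (n + 1) x - w (n - 1) x)
        + tavg (\<lambda>m. u m x) n * complex_of_real (G x) * cnj (u (n + 1) x - u (n - 1) x)) =
      1 / 2 * (((cmod (w (n + 1) x))\<^sup>2 + F ((cmod (u (n + 1) x))\<^sup>2))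
        - ((cmod (w (n - 1) x))\<^sup>2 + F ((cmod (u (n - 1) x))\<^sup>2)))" for x
    proof -
      have "Re (\<i> * tdiff h (\<lambda>m. u m x) n * cnj (u (n + 1) x - u (n - 1) x)) = 0"
        by (simp add: tdiff_def field_simps)
      moreover have "Re (tavg (\<lambda>m. w m x) n * cnj (w (n + 1) x - w (n - 1) x)) =
          ((cmod (w (n + 1) x))\<^sup>2 - (cmod (w (n - 1) x))\<^sup>2) / 2"
        unfolding tavg_def by (rule Re_mean_times_difference)
      moreover have "Re (tavg (\<lambda>m. u m x) n * complex_of_real (G x) * cnj (u (n + 1) x - u (n - 1) x)) =
          (F ((cmod (u (n + 1) x))\<^sup>2) - F ((cmod (u (n - 1) x))\<^sup>2)) / 2"
      proof -
        have "tavg (\<lambda>m. u m x) n * complex_of_real (G x) * cnj (u (n + 1) x - u (n - 1) x) =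
            tavg (\<lambda>m. u m x) n * cnj (u (n + 1) x - u (n - 1) x) * complex_of_real (G x)"
          by (simp only: ac_simps)
        moreover have "Re (tavg (\<lambda>m. u m x) n * cnj (u (n + 1) x - u (n - 1) x)) =
            ((cmod (u (n + 1) x))\<^sup>2 - (cmod (u (n - 1) x))\<^sup>2) / 2"
          unfolding tavg_def by (rule Re_mean_times_difference)
        moreover have Re_of_real: "Re (z * complex_of_real (G x)) = Re z * G x" for z
          by simp
        ultimately show ?thesis
          using G[of x] by (simp only: Re_of_real) simp
      qed
      ultimately show ?thesis by simp
    qed
    have "0 = Re (\<Sum>J\<in>cells N. LINT x:elem X J|lborel.
        \<i> * tdiff h (\<lambda>m. u m x) n * cnj (u (n + 1) x - u (n - 1) x)
        + tavg (\<lambda>m. w m x) n * cnj (w (n + 1) x - w (n - 1) x)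
        + tavg (\<lambda>m. u m x) n * complex_of_real (G x) * cnj (u (n + 1) x - u (n - 1) x))"
      using t(2) by (simp del: complex_cnj_diff)
    also have "\<dots> = (\<Sum>J\<in>cells N. LINT x:elem X J|lborel.
        1 / 2 * (((cmod (w (n + 1) x))\<^sup>2 + F ((cmod (u (n + 1) x))\<^sup>2))
        - ((cmod (w (n - 1) x))\<^sup>2 + F ((cmod (u (n - 1) x))\<^sup>2))))"
      unfolding Re_sum by (intro sum.cong refl) (simp only: set_integral_Re[OF t(1)] Re_eq)
    finally show ?thesis
      by (simp only: set_integral_mult_right flip: sum_distrib_left)
  qed
  then have ham: "(\<Sum>J\<in>cells N. LINT x:elem X J|lborel. (cmod (w (n + 1) x))\<^sup>2 + F ((cmod (u (n + 1) x))\<^sup>2)) =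
      (\<Sum>J\<in>cells N. LINT x:elem X J|lborel. (cmod (w (n - 1) x))\<^sup>2 + F ((cmod (u (n - 1) x))\<^sup>2))"
    using sq_int[OF dg(2)] F_int[OF dg(1)] by (simp add: set_integral_diff sum_subtractf)

  show "discrete_mass N X u (n + 1) = discrete_mass N X u n \<and>
        discrete_hamiltonian F N X u w (n + 1) = discrete_hamiltonian F N X u w n"
  proof
    show "discrete_mass N X u (n + 1) = discrete_mass N X u n"
      using mass sq_int[OF dg(1)]
      by (simp add: discrete_mass_def set_integral_add sum.distrib cong: sum.cong)
    show "discrete_hamiltonian F N X u w (n + 1) = discrete_hamiltonian F N X u w n"
      using ham sq_int[OF dg(2)] F_int[OF dg(1)]
      by (simp add: discrete_hamiltonian_def set_integral_add sum.distrib cong: sum.cong)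
  qed
qed

end
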